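(* Let $N\in\{2,3,5,7\}$ and let $\tilde E_N(\tau)=\frac{1}{N-1}\bigl(NE_2(N\tau)-E_2(\tau)\bigr)$ for $\tau$ in the upper half plane $\mathbb{H}$. Let $\rho=e^{2\pi i/3}$. Then the set of zeros of $\tilde E_N$ lying in the fundamental domain $F_N$ of $\Gamma_0(N)$ is exactly: - for $N=2$: $\left\{-\frac{1}{i+1}\right\}$; - for $N=3$: $\left\{-\frac{1}{\rho+2}\right\}$; - for $N=5$: $\left\{-\frac{1}{i+2},\,-\frac{1}{i+3}\right\}$; - for $N=7$: $\left\{-\frac{1}{\rho+3},\,-\frac{1}{\rho+5}\right\}$. In particular $\tilde E_N$ vanishes at each of these points and at no other point of $F_N$.
   Context: $q=e^{2\pi i\tau}$ with $\tau\in\mathbb{H}$. $E_2(\tau)=1-24\sum_{n\ge1}\sigma_1(n)q^n$, where $\sigma_1(n)$ is the sum of the positive divisors of $n$. For $N$ prime, $\tilde E_N$ is a holomorphic modular form of weight $2$ for $\Gamma_0(N)$. Let $F_\Gamma=\{\tau=x+iy\in\mathbb{H}: -1/2\le x<1/2,\ x^2+y^2\ge1\}$ be the standard fundamental domain of $SL_2(\mathbb{Z})$, $S=\begin{pmatrix}0&-1\\1&0\end{pmatrix}$, $T=\begin{pmatrix}1&1\\0&1\end{pmatrix}$, acting by Möbius transformations (so $ST^k(\tau)=-1/(\tau+k)$). For a prime $p$, the fundamental domain of $\Gamma_0(p)$ is taken to be $F_p=F_\Gamma\cup\bigcup_{k=0}^{p-1}ST^k(F_\Gamma)$. *)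

theory Defs
  imports "HOL-Analysis.Analysis"
begin

definition sigma1 :: "nat \<Rightarrow> nat" where
  "sigma1 n = (\<Sum>d\<in>{d. d dvd n}. d)"

definition qpar :: "complex \<Rightarrow> complex" where
  "qpar \<tau> = exp (2 * of_real pi * \<i> * \<tau>)"

definition E2 :: "complex \<Rightarrow> complex" where
  "E2 \<tau> = 1 - 24 * (\<Sum>n. of_nat (sigma1 (Suc n)) * qpar \<tau> ^ Suc n)"

definition Etilde :: "nat \<Rightarrow> complex \<Rightarrow> complex" where
  "Etilde N \<tau> = (of_nat N * E2 (of_nat N * \<tau>) - E2 \<tau>) / (of_nat N - 1)"

definition F_Gamma :: "complex set" where
  "F_Gamma = {\<tau>. Im \<tau> > 0 \<and> -1/2 \<le> Re \<tau> \<and> Re \<tau> < 1/2 \<and> Re \<tau>^2 + Im \<tau>^2 \<ge> 1}"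

definition ST :: "nat \<Rightarrow> complex \<Rightarrow> complex" where
  "ST k \<tau> = - 1 / (\<tau> + of_nat k)"

definition F_level :: "nat \<Rightarrow> complex set" where
  "F_level p = F_Gamma \<union> (\<Union>k\<in>{0..<p}. ST k ` F_Gamma)"

definition rho :: complex where
  "rho = exp (2 * of_real pi * \<i> / 3)"

end

theory Submission
  imports Defs "HOL-Complex_Analysis.Complex_Analysis"
begin

text \<open>
  Multiply \<open>Etilde N\<close> by its conjugates \<open>Etilde N ((\<tau> + k) / N)\<close>, \<open>k < N\<close>, over the \<open>N + 1\<close> cosets of
  \<open>\<Gamma>\<^sub>0(N)\<close> in \<open>SL\<^sub>2(\<int>)\<close>. The product \<open>P\<close> is a level-one form of weight \<open>2N + 2\<close> with constant term 1. Let
  \<open>a = \<i>\<close>, \<open>E = E6\<close> for \<open>N = 2, 5\<close> and \<open>a = rho\<close>, \<open>E = E4\<close> for \<open>N = 3, 7\<close>. The factors attached to the elliptic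
  points of \<open>\<Gamma>\<^sub>0(N)\<close> vanish at \<open>a\<close> (to order 1 at \<open>\<i>\<close> and to order 2 at \<open>rho\<close>), so \<open>P\<close> vanishes at \<open>a\<close> to order
  \<open>m = (2N + 2) / weight(E)\<close>. As \<open>E\<close> has a simple zero at \<open>a\<close> and no other zero in the fundamental domain,
  \<open>P / E\<^sup>m\<close> is holomorphic of weight 0, hence constantly 1 by the maximum modulus principle. So no factor
  vanishes in \<open>F_Gamma\<close> except the elliptic ones at \<open>a\<close>. No valence formula is needed: the zeros of \<open>E4\<close> and \<open>E6\<close>
  are found by observing that, as functions of \<open>q\<close>, these forms are injective for \<open>\<bar>q\<bar> < 1/190\<close>.
\<close>

section \<open>Partial fractions of the cotangent and of its derivative\<close>

text \<open>The four levels are those where forced zeros exhaust the weight: 2N + 2 equals 6 =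
  6*1*1, 8 = 4*2*1, 12 = 6*1*2 and 16 = 4*2*2 for N = 2, 3, 5, 7, each time the weight of E times
  the forced order times the number of elliptic cosets. The coset with index k is elliptic at i if
  k^2 = -1 mod N, and at rho if (k - 1) k = -1 mod N. The obstacle is the law of \<open>E2\<close>
  under \<tau> -> -1/\<tau>: \<open>E2\<close> is given only as a q-series, and its lattice sum
  converges conditionally. It is the only lattice sum that occurs, because \<open>E4\<close> and
  \<open>E6\<close> are built from \<open>E2\<close> and its derivatives and inherit their laws by
  differentiation. The constants: all work near \<open>F_Gamma\<close> takes place in Im \<tau> >
  17/20, an open half plane reaching just below the height sqrt 3 / 2 of rho. There |q| < 1/190, and
  on this disc E4 - 240 q and E6 + 504 q have Lipschitz constants at most 100 and 450. As these are
  less than 240 and 504, injectivity follows.\<close>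

lemma Digamma_reflection:
  fixes z :: complex
  assumes z: "z \<notin> \<int>"
  shows "Digamma (1 - z) - Digamma z = of_real pi * cot (of_real pi * z)"
proof -
  have z': "1 - z \<notin> \<int>"
    using z by (metis Ints_1 Ints_diff diff_diff_eq2 add_diff_cancel_left')
  have np: "z \<notin> \<int>\<^sub>\<le>\<^sub>0" "1 - z \<notin> \<int>\<^sub>\<le>\<^sub>0"
    using z z' nonpos_Ints_subset_Ints by blast+
  \<comment> \<open>The cotangent is the logarithmic derivative of the sine, so both sides of the
    reflection formula are differentiated.\<close>
  have eq: "rGamma w * rGamma (1 - w) = sin (of_real pi * w) / of_real pi" for w :: complex
    by (rule rGamma_reflection_complex)
  have d1: "((\<lambda>w. rGamma w * rGamma (1 - w)) has_field_derivative
     rGamma z * rGamma (1 - z) * (Digamma (1 - z) - Digamma z)) (at z)"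
    using np by (auto intro!: derivative_eq_intros simp: algebra_simps)
  have d2: "((\<lambda>w. sin (of_real pi * w) / of_real pi) has_field_derivative cos (of_real pi * z)) (at z)"
    by (auto intro!: derivative_eq_intros)
  have "rGamma z * rGamma (1 - z) * (Digamma (1 - z) - Digamma z) = cos (of_real pi * z)"
    using d1 d2 unfolding eq by (rule DERIV_unique)
  moreover have "sin (of_real pi * z) \<noteq> 0"
    using eq[of z] np by (auto simp: rGamma_eq_zero_iff)
  ultimately show ?thesis unfolding eq cot_def by (simp add: field_simps)
qed

text \<open>Derivative of \<open>Digamma_reflection\<close>, which may be differentiated because the
  non-integers form an open set.\<close>

lemma Polygamma_1_reflection:
  fixes z :: complex
  assumes z: "z \<notin> \<int>"
  shows "Polygamma 1 z + Polygamma 1 (1 - z) = of_real pi ^ 2 / sin (of_real pi * z) ^ 2"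
proof -
  have z': "1 - z \<notin> \<int>"
    using z by (metis Ints_1 Ints_diff diff_diff_eq2 add_diff_cancel_left')
  have np: "z \<notin> \<int>\<^sub>\<le>\<^sub>0" "1 - z \<notin> \<int>\<^sub>\<le>\<^sub>0"
    using z z' nonpos_Ints_subset_Ints by blast+
  have s: "sin (of_real pi * z) \<noteq> 0"
    using rGamma_reflection_complex[of z] np by (auto simp: rGamma_eq_zero_iff)
  have d1: "((\<lambda>w. Digamma (1 - w) - Digamma w) has_field_derivative
     - Polygamma 1 (1 - z) - Polygamma 1 z) (at z)"
    using np by (auto intro!: derivative_eq_intros)
  have d2: "((\<lambda>w. of_real pi * cot (of_real pi * w)) has_field_derivative
     - (of_real pi ^ 2) / sin (of_real pi * z) ^ 2) (at z)"
  proof -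
    let ?s = "sin (of_real pi * z)" and ?c = "cos (of_real pi * z)"
    have "((\<lambda>w. of_real pi * cot (of_real pi * w)) has_field_derivative
       of_real pi * ((- ?s * of_real pi * ?s - ?c * (?c * of_real pi)) / (?s * ?s))) (at z)"
      unfolding cot_def using s by (auto intro!: derivative_eq_intros simp: algebra_simps)
    moreover have "- s * p * s - c * (c * p) = - (s^2 + c^2) * p" for s c p :: complex
      by (simp add: algebra_simps power2_eq_square)
    hence "- ?s * of_real pi * ?s - ?c * (?c * of_real pi) = - of_real pi"
      by (metis mult_minus1 sin_cos_squared_add)
    ultimately show ?thesis by (simp add: power2_eq_square)
  qed
  have op: "open (- \<int> :: complex set)" using closed_Ints by (rule open_Compl)
  have "((\<lambda>w. of_real pi * cot (of_real pi * w)) has_field_derivative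
     - Polygamma 1 (1 - z) - Polygamma 1 z) (at z)"
    by (rule has_field_derivative_transform_within_open[OF d1 op]) (use z in \<open>auto simp: Digamma_reflection\<close>)
  from DERIV_unique[OF this d2] show ?thesis by (simp add: algebra_simps minus_equation_iff)
qed

lemma filterlim_symmetric_int:
  "filterlim (\<lambda>M::nat. {- int M..int M}) (finite_subsets_at_top UNIV) sequentially"
proof (subst filterlim_finite_subsets_at_top, safe)
  fix X :: "int set" assume X: "finite X"
  have "\<forall>\<^sub>F M in sequentially. \<forall>x\<in>X. \<bar>x\<bar> \<le> int M"
    using X
  proof (rule eventually_ball_finite, safe)
    fix x :: int
    show "\<forall>\<^sub>F M in sequentially. \<bar>x\<bar> \<le> int M"
      by (rule eventually_sequentiallyI[of "nat \<bar>x\<bar>"]) auto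
  qed
  thus "\<forall>\<^sub>F M in sequentially. finite {- int M..int M} \<and> X \<subseteq> {- int M..int M} \<and> {- int M..int M} \<subseteq> UNIV"
    by eventually_elim (auto simp: abs_le_iff)
qed

text \<open>Lets unconditional sums be compared with series such as that of the cotangent, which
  converge only along symmetric ranges.\<close>

lemma has_sum_int_symmetric_limit:
  assumes "(f has_sum S) (UNIV :: int set)"
  shows "(\<lambda>M::nat. \<Sum>m\<in>{- int M..int M}. f m) \<longlonglongrightarrow> S"
  using assms filterlim_symmetric_int unfolding has_sum_def
  by (rule filterlim_compose[of "sum f"])

lemma sum_symmetric_int:
  fixes f :: "int \<Rightarrow> 'a::comm_monoid_add"
  shows "(\<Sum>m\<in>{- int M..int M}. f m) = f 0 + (\<Sum>k=1..M. f (int k) + f (- int k))"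
proof (induction M)
  case (Suc M)
  have "{- int (Suc M)..int (Suc M)} = insert (int (Suc M)) (insert (- int (Suc M)) {- int M..int M})"
    by auto
  thus ?case by (simp add: Suc ac_simps)
qed auto

text \<open>Both digamma values are limits of ln m minus a partial sum; in their difference the
  logarithms cancel. A limit is all that can be had, as 1/(z + n) is not absolutely
  summable.\<close>

lemma cot_symmetric_limit:
  fixes z :: complex
  assumes z: "z \<notin> \<int>"
  shows "(\<lambda>M::nat. \<Sum>n\<in>{- int M..int M}. 1 / (z + of_int n)) \<longlonglongrightarrow> of_real pi * cot (of_real pi * z)"
proof -
  have z0: "z \<noteq> 0" "1 - z \<noteq> 0" "z + of_int n \<noteq> 0" for n
    using z by (auto simp: add_eq_0_iff2 minus_in_Ints_iff)
  have "(\<lambda>m. of_real (ln (real m)) - (\<Sum>n<m. inverse (1 - z + of_nat n))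
     - (of_real (ln (real m)) - (\<Sum>n<m. inverse (z + of_nat n)))) \<longlonglongrightarrow> Digamma (1 - z) - Digamma z"
    by (intro tendsto_diff Digamma_LIMSEQ z0)
  hence lim: "(\<lambda>m. (\<Sum>n<m. inverse (z + of_nat n)) - (\<Sum>n<m. inverse (1 - z + of_nat n)))
     \<longlonglongrightarrow> of_real pi * cot (of_real pi * z)"
    by (simp add: Digamma_reflection[OF z])
  \<comment> \<open>The two digamma sums cover the shifts -m, ..., m - 1. The missing shift m
    contributes a term that tends to 0.\<close>
  have "filterlim (\<lambda>m::nat. z + of_nat m) at_infinity sequentially"
    by (intro tendsto_add_filterlim_at_infinity[OF tendsto_const] tendsto_of_nat)
  hence "(\<lambda>m. inverse (z + of_nat m)) \<longlonglongrightarrow> 0"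
    by (rule filterlim_compose[OF tendsto_inverse_0])
  from tendsto_add[OF lim this]
  have lim: "(\<lambda>m. (\<Sum>n<m. inverse (z + of_nat n)) - (\<Sum>n<m. inverse (1 - z + of_nat n)) + inverse (z + of_nat m))
     \<longlonglongrightarrow> of_real pi * cot (of_real pi * z)" by simp
  have "(\<Sum>n<m. inverse (z + of_nat n)) - (\<Sum>n<m. inverse (1 - z + of_nat n)) + inverse (z + of_nat m)
     = (\<Sum>n\<in>{- int m..int m}. 1 / (z + of_int n))" for m
  proof (induction m)
    case (Suc m)
    have "inverse (1 - z + of_nat m) = - (1 / (z - (1 + of_nat m)))"
      by (metis (no_types, opaque_lifting) diff_add_eq diff_diff_eq2 inverse_eq_divide minus_diff_eq minus_divide_right)
    with Suc show ?case unfolding sum_symmetric_int by (simp add: inverse_eq_divide algebra_simps)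
  qed (auto simp: inverse_eq_divide)
  with lim show ?thesis by simp
qed

text \<open>The terms with n \<ge> 0 add up to \<open>Polygamma 1 z\<close>; those with n = -k - 1,
  k \<ge> 0, add up to \<open>Polygamma 1 (1 - z)\<close>.\<close>

lemma has_sum_shifted_inverse_squares:
  fixes z :: complex
  assumes z: "z \<notin> \<int>"
  shows "((\<lambda>n::int. 1 / (z + of_int n) ^ 2) has_sum (of_real pi ^ 2 / sin (of_real pi * z) ^ 2)) UNIV"
proof -
  have z0: "z \<noteq> 0" "1 - z \<noteq> 0" using z by auto
  have hs: "((\<lambda>k. inverse ((w + of_nat k)^2)) has_sum Polygamma 1 w) UNIV" if "w \<noteq> 0" for w :: complex
  proof -
    have sm: "(\<lambda>k. inverse ((w + of_nat k)^2)) sums Polygamma 1 w"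
      using Polygamma_LIMSEQ[OF that, of 1] by (simp add: numeral_2_eq_2)
    have "summable (\<lambda>k. norm (inverse ((w + of_nat k)^2)))"
    proof (rule summable_comparison_test_ev[where g="\<lambda>k. 4 * inverse (real k ^ 2)"])
      have "\<forall>\<^sub>F k in sequentially. real k \<ge> 2 * norm w + 1"
        using filterlim_real_sequentially by (auto simp: filterlim_at_top)
      thus "\<forall>\<^sub>F k in sequentially. norm (norm (inverse ((w + of_nat k)^2))) \<le> 4 * inverse (real k ^ 2)"
      proof eventually_elim
        case (elim k)
        have "norm (w + of_nat k) \<ge> real k - norm w"
          by (metis add.commute norm_diff_ineq norm_of_nat)
        hence "norm (w + of_nat k) \<ge> real k / 2" using elim by linarith
        hence "norm (w + of_nat k) ^ 2 \<ge> (real k / 2) ^ 2" by (intro power_mono) auto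
        moreover have k: "real k > 0" using elim norm_ge_zero[of w] by linarith
        ultimately have "inverse (norm (w + of_nat k) ^ 2) \<le> inverse ((real k / 2) ^ 2)"
          by (intro le_imp_inverse_le) auto
        also have "\<dots> = 4 * inverse (real k ^ 2)" by (simp add: field_simps)
        finally show ?case by (simp add: norm_inverse norm_power)
      qed
      show "summable (\<lambda>k. 4 * inverse (real k ^ 2))"
        using inverse_power_summable[of 2, where 'a=real] by (intro summable_mult) auto
    qed
    thus ?thesis using sm by (rule norm_summable_imp_has_sum)
  qed
  have 1: "((\<lambda>n::int. 1 / (z + of_int n) ^ 2) has_sum Polygamma 1 z) {0..}"
    using hs[OF z0(1)]
    by (rule has_sum_reindex_bij_witness[of _ nat int, THEN iffD1, rotated -1]) (auto simp: inverse_eq_divide)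
  have 2: "((\<lambda>n::int. 1 / (z + of_int n) ^ 2) has_sum Polygamma 1 (1-z)) {..<0}"
    using hs[OF z0(2)]
    by (rule has_sum_reindex_bij_witness[of _ "\<lambda>n. nat (-n-1)" "\<lambda>k. - int k - 1", THEN iffD1, rotated -1])
       (auto simp: inverse_eq_divide power2_commute algebra_simps)
  have "((\<lambda>n::int. 1 / (z + of_int n) ^ 2) has_sum (Polygamma 1 z + Polygamma 1 (1-z))) ({0..} \<union> {..<0})"
    by (intro has_sum_Un_disjoint 1 2) auto
  moreover have "{0..} \<union> {..<0::int} = UNIV" by auto
  ultimately show ?thesis by (simp only: Polygamma_1_reflection[OF z])
qed

section \<open>The transformation law of E2\<close>

text \<open>The imaginary part controls n, and then the triangle inequality controls m in terms of
  n. The summand 1 in the denominator lets a single constant serve both variables, including m =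
  0.\<close>

lemma norm_lattice_ge:
  assumes \<tau>: "Im \<tau> > 0" and n: "n \<noteq> (0::int)"
  shows "norm (of_int m + of_int n * \<tau>) \<ge> Im \<tau> / (1 + Im \<tau> + norm \<tau>) * max 1 \<bar>of_int m\<bar>"
    and "norm (of_int m + of_int n * \<tau>) \<ge> Im \<tau> / (1 + Im \<tau> + norm \<tau>) * \<bar>of_int n\<bar>"
    and "norm (of_int m + of_int n * \<tau>) \<ge> Im \<tau>"
proof -
  let ?X = "norm (of_int m + of_int n * \<tau>)"
  define y where "y = Im \<tau>"
  have y: "y > 0" using \<tau> by (simp add: y_def)
  have "\<bar>Im (of_int m + of_int n * \<tau>)\<bar> \<le> ?X" by (rule abs_Im_le_cmod)
  hence X: "y * \<bar>of_int n\<bar> \<le> ?X" by (simp add: y_def abs_mult \<tau> less_imp_le mult_ac)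
  have n1: "\<bar>of_int n :: real\<bar> \<ge> 1" using n by linarith
  hence "y * 1 \<le> y * \<bar>of_int n\<bar>" using y by (intro mult_left_mono) auto
  with X show Xy: "?X \<ge> Im \<tau>" unfolding y_def by linarith
  have "norm (of_int m :: complex) \<le> ?X + norm (of_int n * \<tau>)"
    using norm_triangle_ineq4[of "of_int m + of_int n * \<tau>" "of_int n * \<tau>"] by simp
  hence m: "\<bar>of_int m\<bar> \<le> ?X + \<bar>of_int n\<bar> * norm \<tau>" by (simp add: norm_mult)
  have "y * \<bar>of_int m\<bar> \<le> y * ?X + (y * \<bar>of_int n\<bar>) * norm \<tau>"
    using mult_left_mono[OF m, of y] y by (simp add: algebra_simps)
  also have "\<dots> \<le> y * ?X + ?X * norm \<tau>"
    using X by (intro add_left_mono mult_right_mono) auto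
  also have "\<dots> \<le> ?X * (1 + y + norm \<tau>)"
    unfolding distrib_left by (simp add: mult.commute)
  finally have "y * \<bar>of_int m\<bar> \<le> ?X * (1 + y + norm \<tau>)" .
  moreover have "y * 1 \<le> ?X * (1 + y + norm \<tau>)"
    using Xy y mult_left_mono[of 1 "1 + y + norm \<tau>" ?X] by (simp add: y_def)
  ultimately have "y * max 1 \<bar>of_int m\<bar> \<le> ?X * (1 + y + norm \<tau>)" by (simp add: max_def)
  thus "?X \<ge> Im \<tau> / (1 + Im \<tau> + norm \<tau>) * max 1 \<bar>of_int m\<bar>"
    using y by (simp add: y_def[symmetric] field_simps add_pos_nonneg)
  have "y * \<bar>of_int n\<bar> \<le> ?X * (1 + y + norm \<tau>)"
    using X y mult_left_mono[of 1 "1 + y + norm \<tau>" ?X] by simp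
  thus "?X \<ge> Im \<tau> / (1 + Im \<tau> + norm \<tau>) * \<bar>of_int n\<bar>"
    using y by (simp add: y_def[symmetric] field_simps add_pos_nonneg)
qed

text \<open>The exponent is half of the cubic decay of the corrected summand, and still less than
  -1. Without \<open>max 1\<close> the majorant would be 0 at m = 0.\<close>

lemma summable_on_int_powr:
  "(\<lambda>m::int. max 1 \<bar>of_int m\<bar> powr (- 3 / 2) :: real) summable_on UNIV"
proof -
  have s: "(\<lambda>k::nat. max 1 (real k) powr (- 3 / 2)) summable_on UNIV"
  proof (rule norm_summable_imp_summable_on)
    have "summable (\<lambda>k::nat. real k powr (- 3 / 2))" by (simp add: summable_real_powr_iff)
    moreover have "\<forall>\<^sub>F k::nat in sequentially. real k powr (- 3 / 2) = norm (max 1 (real k) powr (- 3 / 2))"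
      by (rule eventually_sequentiallyI[of 1]) auto
    ultimately show "summable (\<lambda>k::nat. norm (max 1 (real k) powr (- 3 / 2)))"
      by (subst (asm) summable_cong) auto
  qed
  have 1: "(\<lambda>m::int. max 1 \<bar>of_int m\<bar> powr (- 3 / 2) :: real) summable_on {0..}"
    using s by (rule summable_on_reindex_bij_witness[of _ nat int, THEN iffD1, rotated -1]) auto
  have "(\<lambda>m::int. max 1 \<bar>of_int m\<bar> powr (- 3 / 2) :: real) summable_on {..0}"
    using s by (rule summable_on_reindex_bij_witness[of _ "\<lambda>m. nat (- m)" "\<lambda>k. - int k", THEN iffD1, rotated -1]) auto
  hence 2: "(\<lambda>m::int. max 1 \<bar>of_int m\<bar> powr (- 3 / 2) :: real) summable_on {..<0}"
    by (rule summable_on_subset_banach) auto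
  have "(\<lambda>m::int. max 1 \<bar>of_int m\<bar> powr (- 3 / 2) :: real) summable_on ({0..} \<union> {..<0})"
    by (intro summable_on_Un_disjoint 1 2) auto
  moreover have "{0..} \<union> {..<0::int} = UNIV" by auto
  ultimately show ?thesis by simp
qed

text \<open>With w = m + n\<tau> the summand collapses to -1 / (w^2 (w - 1)), which is of cubic
  size. The decay is shared evenly, |w|^(-3/2) for each of the two variables.\<close>

lemma Eisenstein_summable:
  assumes \<tau>: "Im \<tau> > 0"
  shows "(\<lambda>(n::int, m::int). 1 / (of_int m + of_int n * \<tau>) ^ 2 -
            (1 / (of_int (m - 1) + of_int n * \<tau>) - 1 / (of_int m + of_int n * \<tau>)))
           summable_on ((UNIV - {0}) \<times> UNIV)" (is "?f summable_on _")
proof -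
  define y where "y = Im \<tau>"
  define c where "c = y / (1 + y + norm \<tau>)"
  have y: "y > 0" and c: "c > 0" using \<tau> by (auto simp: y_def c_def add_pos_nonneg)
  define p where "p = (\<lambda>m::int. max 1 \<bar>of_int m\<bar> powr (- 3 / 2) :: real)"
  define C where "C = (1 + 1 / y) * c powr (-3)"
  have p: "p summable_on A" for A
    using summable_on_int_powr summable_on_subset_banach unfolding p_def by blast
  have pp: "(\<lambda>(n, m). p n * p m) summable_on ((UNIV - {0}) \<times> UNIV)"
  proof (rule summable_on_SigmaI)
    show "((\<lambda>m. case (n, m) of (n, m) \<Rightarrow> p n * p m) has_sum p n * infsum p UNIV) UNIV" for n
      using p by (auto intro!: has_sum_cmult_right)
    show "(\<lambda>n. p n * infsum p UNIV) summable_on UNIV - {0}"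
      by (intro summable_on_cmult_left p)
  qed (auto simp: p_def)
  have bound: "norm (?f (n, m)) \<le> C * (p n * p m)" if n: "n \<noteq> 0" for n m
  proof -
    define w where "w = of_int m + of_int n * \<tau>"
    define X where "X = norm w"
    have w1: "of_int (m - 1) + of_int n * \<tau> = w - 1" by (simp add: w_def)
    have Xm: "X \<ge> c * max 1 \<bar>of_int m\<bar>" and Xn: "X \<ge> c * \<bar>of_int n\<bar>" and Xy: "X \<ge> y"
      using norm_lattice_ge[OF \<tau> n, of m] by (auto simp: X_def w_def c_def y_def)
    have Y: "norm (w - 1) \<ge> y"
      using norm_lattice_ge(3)[OF \<tau> n, of "m - 1"] unfolding w1 y_def .
    have X0: "X > 0" using Xy y by linarith
    \<comment> \<open>|w| and |w - 1| are comparable since |w - 1| \<ge> y. This replaces |w|^2 |w -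
      1| by |w|^3.\<close>
    have XY: "X \<le> norm (w - 1) * (1 + 1 / y)"
    proof -
      have "X \<le> norm (w - 1) + 1" unfolding X_def using norm_triangle_ineq[of "w - 1" 1] by simp
      moreover have "1 \<le> norm (w - 1) * (1 / y)" using Y y by (simp add: field_simps)
      ultimately show ?thesis by (simp add: algebra_simps)
    qed
    have "1 / X ^ 3 = X powr (- 3 / 2) * X powr (- 3 / 2)"
      using X0 powr_add[of X "- 3 / 2" "- 3 / 2"] powr_minus_divide[of X 3] by simp
    also have "\<dots> \<le> (c * \<bar>of_int n\<bar>) powr (- 3 / 2) * (c * max 1 \<bar>of_int m\<bar>) powr (- 3 / 2)"
    proof -
      have "c * \<bar>of_int n\<bar> > 0" "c * max 1 \<bar>of_int m\<bar> > 0" using c n by auto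
      hence "X powr (- 3 / 2) \<le> (c * \<bar>of_int n\<bar>) powr (- 3 / 2)"
            "X powr (- 3 / 2) \<le> (c * max 1 \<bar>of_int m\<bar>) powr (- 3 / 2)"
        using Xm Xn powr_mono2'[of "- 3 / 2"] by auto
      thus ?thesis by (rule mult_mono) auto
    qed
    also have "\<dots> = c powr (- 3) * (p n * p m)"
    proof -
      have "max 1 \<bar>of_int n\<bar> = \<bar>of_int n :: real\<bar>" using n by linarith
      moreover have "c powr (- 3 / 2) * c powr (- 3 / 2) = c powr (- 3)"
        using powr_add[of c "- 3 / 2" "- 3 / 2"] by simp
      ultimately show ?thesis using c by (simp add: powr_mult p_def mult_ac)
    qed
    finally have cube: "1 / X ^ 3 \<le> c powr (- 3) * (p n * p m)" .
    have w0: "w \<noteq> 0" "w - 1 \<noteq> 0" using X0 Y y by (auto simp: X_def)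
    have "?f (n, m) = 1 / w ^ 2 - (1 / (w - 1) - 1 / w)" using w1 by (simp add: w_def)
    also have "\<dots> = - 1 / (w ^ 2 * (w - 1))"
      using w0 by (simp add: divide_simps) (simp add: algebra_simps power2_eq_square)
    finally have "norm (?f (n, m)) = 1 / (X ^ 2 * norm (w - 1))"
      by (simp add: norm_divide norm_mult norm_power X_def)
    also have "\<dots> \<le> (1 + 1 / y) / X ^ 3"
      using XY X0 w0 y by (simp add: field_simps power3_eq_cube power2_eq_square)
    also have "\<dots> \<le> (1 + 1 / y) * (c powr (- 3) * (p n * p m))"
      using mult_left_mono[OF cube, of "1 + 1 / y"] y by simp
    finally show ?thesis by (simp add: C_def mult_ac)
  qed
  show ?thesis
    by (rule abs_summable_summable, rule Infinite_Sum.abs_summable_on_comparison_test'[OF summable_on_cmult_right[OF pp, of C]])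
       (use bound in auto)
qed

section \<open>Lambert series and the q-expansion of E2\<close>

text \<open>Every number divides 0, so the index set is infinite and the sum takes its default
  value. Series may therefore start at 0.\<close>

lemma sigma1_0 [simp]: "sigma1 0 = 0"
  by (simp add: sigma1_def sum.infinite)

lemma has_sum_nat_times_power:
  fixes x :: "'a :: {real_normed_field, banach}"
  assumes x: "norm x < 1"
  shows "((\<lambda>d. of_nat d * x ^ d) has_sum x / (1 - x) ^ 2) {1..}"
proof -
  have "(\<lambda>n. x * (of_nat (Suc n) * x ^ n)) sums (x * (1 / (1 - x) ^ 2))"
    by (intro sums_mult geometric_deriv_sums x)
  moreover have "summable (\<lambda>n. norm (x * (of_nat (Suc n) * x ^ n)))"
  proof -
    have "summable (\<lambda>n. norm x * (of_nat (Suc n) * norm x ^ n))"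
      using geometric_deriv_sums[of "norm x"] x by (intro summable_mult) (auto simp: sums_iff)
    thus ?thesis by (simp add: norm_mult norm_power del: of_nat_Suc)
  qed
  ultimately have "((\<lambda>n. x * (of_nat (Suc n) * x ^ n)) has_sum (x * (1 / (1 - x) ^ 2))) UNIV"
    by (intro norm_summable_imp_has_sum)
  also have "?this \<longleftrightarrow> ((\<lambda>d. of_nat d * x ^ d) has_sum (x * (1 / (1 - x) ^ 2))) {1..}"
    by (rule has_sum_reindex_bij_witness[of _ "\<lambda>n. n - 1" Suc])
       (auto simp: mult_ac simp flip: power_Suc)
  finally show ?thesis by simp
qed

text \<open>The double sum of d q^(nd) over n, d \<ge> 1 is arranged in two ways: by n, and by the
  product nd. Both families get the same witness \<open>S\<close>, so convergence and equality come
  together.\<close>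

lemma has_sum_Lambert_sigma1:
  fixes q :: complex
  assumes q: "norm q < 1"
  obtains S where "((\<lambda>n. of_nat (sigma1 n) * q ^ n) has_sum S) {1..}"
    and "((\<lambda>n. q ^ n / (1 - q ^ n) ^ 2) has_sum S) {1..}"
proof -
  define f where "f = (\<lambda>(n, d). of_nat d * q ^ (n * d))"
  have qn: "norm (q ^ n) < 1" if "n \<ge> 1" for n
    using q that by (simp add: norm_power power_less_one_iff)
  have row: "((\<lambda>d. f (n, d)) has_sum (q ^ n / (1 - q ^ n) ^ 2)) {1..}" if "n \<in> {1..}" for n
    using has_sum_nat_times_power[OF qn, of n] that by (simp add: f_def power_mult)
  have nrow: "((\<lambda>d. norm (f (n, d))) has_sum (norm q ^ n / (1 - norm q ^ n) ^ 2)) {1..}" if "n \<in> {1..}" for n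
    using has_sum_nat_times_power[of "norm q ^ n"] that qn[of n]
    by (simp add: f_def power_mult norm_mult norm_power)
  have "(\<lambda>x. norm (f x)) summable_on ({1..} \<times> {1..})"
  proof (rule summable_on_SigmaI[OF nrow])
    show "(\<lambda>n. norm q ^ n / (1 - norm q ^ n) ^ 2) summable_on {1..}"
    proof (rule summable_on_comparison_test)
      have "(\<lambda>n. norm q ^ n * (1 / (1 - norm q) ^ 2)) summable_on UNIV"
        using q by (intro summable_on_cmult_left norm_summable_imp_summable_on) (auto simp: norm_power intro!: summable_geometric)
      thus "(\<lambda>n. norm q ^ n * (1 / (1 - norm q) ^ 2)) summable_on {1..}"
        by (rule summable_on_subset_banach) auto
      fix n :: nat assume n: "n \<in> {1..}"
      have "norm q ^ n \<le> norm q ^ 1" using n q by (intro power_decreasing) auto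
      thus "norm q ^ n / (1 - norm q ^ n) ^ 2 \<le> norm q ^ n * (1 / (1 - norm q) ^ 2)"
        using q n unfolding times_divide_eq_right mult_1_right
        by (intro divide_left_mono power_mono mult_pos_pos zero_less_power)
           (auto simp: power_less_one_iff Suc_le_eq)
    qed auto
  qed auto
  hence "f summable_on ({1..} \<times> {1..})" by (rule abs_summable_summable)
  then obtain S where S: "(f has_sum S) ({1..} \<times> {1..})" by (auto simp: summable_on_def)
  have "((\<lambda>n. q ^ n / (1 - q ^ n) ^ 2) has_sum S) {1..}"
    using has_sum_SigmaD[OF S row] by simp
  moreover have aux: "d \<ge> 1 \<and> N div d \<ge> 1 \<and> N div d * d = N" if "N \<ge> 1" "d dvd N" for N d :: nat
    using that by (auto simp: Suc_le_eq div_greater_zero_iff dvd_imp_le intro: Nat.gr0I)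
  have "((\<lambda>(N, d). of_nat d * q ^ N) has_sum S) (SIGMA N:{1..}. {d. d dvd N})"
    using S
    by (rule has_sum_reindex_bij_witness[of _ "\<lambda>(N, d). (N div d, d)" "\<lambda>(n, d). (n * d, d)", THEN iffD1, rotated -1])
       (use aux in \<open>auto simp: f_def Suc_le_eq\<close>)
  hence "((\<lambda>N. \<Sum>d\<in>{d. d dvd N}. of_nat d * q ^ N) has_sum S) {1..}"
  proof (rule has_sum_SigmaD)
    fix N :: nat assume "N \<in> {1..}"
    hence "finite {d. d dvd N}" by simp
    from has_sum_finite[OF this, of "\<lambda>d. of_nat d * q ^ N"]
    show "((\<lambda>d. case (N, d) of (N, d) \<Rightarrow> of_nat d * q ^ N) has_sum (\<Sum>d\<in>{d. d dvd N}. of_nat d * q ^ N)) {d. d dvd N}"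
      by simp
  qed
  hence "((\<lambda>n. of_nat (sigma1 n) * q ^ n) has_sum S) {1..}"
    by (simp add: sigma1_def flip: sum_distrib_right)
  ultimately show ?thesis using that by blast
qed

lemma norm_qpar: "norm (qpar \<tau>) = exp (- 2 * pi * Im \<tau>)"
  by (simp add: qpar_def)

lemma norm_qpar_less_1: "Im \<tau> > 0 \<Longrightarrow> norm (qpar \<tau>) < 1"
  by (simp add: norm_qpar)

lemma qpar_add: "qpar (x + y) = qpar x * qpar y"
  by (simp add: qpar_def algebra_simps exp_add)

lemma qpar_of_int [simp]: "qpar (of_int n) = 1"
  by (auto simp: qpar_def exp_eq_1)

lemma qpar_of_nat_mult: "qpar (of_nat n * \<tau>) = qpar \<tau> ^ n"
  by (simp add: qpar_def exp_of_nat_mult[symmetric] mult_ac)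

lemma E2_eq_suminf: "E2 \<tau> = 1 - 24 * (\<Sum>n. of_nat (sigma1 n) * qpar \<tau> ^ n)"
proof -
  have "(\<Sum>n. of_nat (sigma1 (Suc n)) * qpar \<tau> ^ Suc n) = (\<Sum>n. of_nat (sigma1 n) * qpar \<tau> ^ n)"
  proof (cases "summable (\<lambda>n. of_nat (sigma1 n) * qpar \<tau> ^ n)")
    case True
    from suminf_split_head[OF this] show ?thesis by simp
  next
    \<comment> \<open>If the series diverges, \<open>suminf\<close> is the same default value on
      both sides, so the identity holds for every \<tau>.\<close>
    case False
    hence "\<not> summable (\<lambda>n. of_nat (sigma1 (Suc n)) * qpar \<tau> ^ Suc n)"
      by (subst summable_Suc_iff)
    with False show ?thesis by (simp add: summable_def suminf_def)
  qed
  thus ?thesis by (simp add: E2_def)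
qed

lemma inverse_sin_squared_eq_qpar:
  assumes z: "Im z > 0"
  shows "of_real pi ^ 2 / sin (of_real pi * z) ^ 2 = - 4 * of_real pi ^ 2 * (qpar z / (1 - qpar z) ^ 2)"
proof -
  define u where "u = exp (\<i> * (of_real pi * z))"
  have u: "u \<noteq> 0" by (simp add: u_def)
  have qu: "qpar z = u ^ 2"
    by (simp add: qpar_def u_def power2_eq_square algebra_simps flip: exp_add)
  have u2: "u ^ 2 \<noteq> 1" using norm_qpar_less_1[OF z] by (auto simp: qu)
  have "sin (of_real pi * z) = (u - 1 / u) / (2 * \<i>)"
    by (simp add: sin_exp_eq u_def exp_minus inverse_eq_divide)
  hence s2: "sin (of_real pi * z) ^ 2 = - ((1 - u ^ 2) ^ 2 / (4 * u ^ 2))"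
  proof -
    have "u - 1 / u = - ((1 - u ^ 2) / u)" using u by (simp add: field_simps power2_eq_square)
    thus "sin (of_real pi * z) = (u - 1 / u) / (2 * \<i>) \<Longrightarrow> ?thesis"
      by (simp add: power_divide power_mult_distrib)
  qed
  show ?thesis unfolding qu s2 using u u2 by (simp add: divide_simps)
qed

text \<open>Up to the factor -4 pi^2, the Lambert terms are the row sums of Eisenstein's double
  series; this is how the q-series meets the lattice.\<close>

lemma has_sum_inverse_sin_squared_E2:
  assumes \<tau>: "Im \<tau> > 0"
  shows "((\<lambda>n. of_real pi ^ 2 / sin (of_real pi * (of_nat n * \<tau>)) ^ 2) has_sum
           (of_real pi ^ 2 / 6 * (E2 \<tau> - 1))) {1..}"
proof -
  define q where "q = qpar \<tau>"
  obtain S where S: "((\<lambda>n. of_nat (sigma1 n) * q ^ n) has_sum S) {1..}"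
    and S2: "((\<lambda>n. q ^ n / (1 - q ^ n) ^ 2) has_sum S) {1..}"
    using has_sum_Lambert_sigma1[of q] norm_qpar_less_1[OF \<tau>] by (auto simp: q_def)
  from S have "((\<lambda>n. of_nat (sigma1 n) * q ^ n) has_sum S) UNIV"
    by (subst (asm) has_sum_cong_neutral[where T = UNIV]) (auto simp: Suc_le_eq)
  hence "(\<lambda>n. of_nat (sigma1 n) * q ^ n) sums S" by (rule has_sum_imp_sums)
  hence E2: "E2 \<tau> = 1 - 24 * S" by (simp add: E2_eq_suminf q_def sums_iff)
  have "((\<lambda>n. - 4 * of_real pi ^ 2 * (q ^ n / (1 - q ^ n) ^ 2)) has_sum (- 4 * of_real pi ^ 2 * S)) {1..}"
    by (intro has_sum_cmult_right S2)
  also have "- 4 * of_real pi ^ 2 * S = of_real pi ^ 2 / 6 * (E2 \<tau> - 1)" by (simp add: E2)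
  also have "((\<lambda>n. - 4 * of_real pi ^ 2 * (q ^ n / (1 - q ^ n) ^ 2)) has_sum (of_real pi ^ 2 / 6 * (E2 \<tau> - 1))) {1..}
    \<longleftrightarrow> ?thesis"
    using \<tau> by (intro has_sum_cong) (subst inverse_sin_squared_eq_qpar, auto simp: q_def qpar_of_nat_mult)
  finally show ?thesis .
qed

section \<open>Boundary terms, partial sums and the law under inversion\<close>

lemma sum_symmetric_int_telescope:
  fixes g :: "int \<Rightarrow> 'a::ab_group_add"
  shows "(\<Sum>m\<in>{- int M..int M}. g (m - 1) - g m) = g (- int M - 1) - g (int M)"
proof (induction M)
  case (Suc M)
  have "{- int (Suc M)..int (Suc M)} = insert (int (Suc M)) (insert (- int (Suc M)) {- int M..int M})"
    by auto
  moreover have "g (- 1 - int M) = g (- int M - 1)" by (rule arg_cong[of _ _ g]) simp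
  ultimately show ?case using Suc by (simp add: algebra_simps)
qed auto

lemma Im_minus_inverse: "Im (- 1 / \<tau>) = Im \<tau> / norm \<tau> ^ 2"
  by (simp add: Im_divide cmod_power2)

lemma Im_minus_inverse_pos: "Im \<tau> > 0 \<Longrightarrow> Im (- 1 / \<tau>) > 0"
  unfolding Im_minus_inverse by (auto intro!: divide_pos_pos)

lemma not_Ints_if_Im_nonzero: "Im z \<noteq> 0 \<Longrightarrow> z \<notin> \<int>"
  using complex_is_Int_iff by blast

text \<open>Applied at 1/\<tau>, this evaluates the boundary term of the telescoping sum. In the
  lower half plane exp(-2 pi i n z) tends to 0, hence the sign of the limit.\<close>

lemma cot_limit_lower:
  assumes z: "Im z < 0"
  shows "(\<lambda>n. cot (of_real pi * (of_nat n * z))) \<longlonglongrightarrow> \<i>"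
proof -
  define x where "x = qpar (- z)"
  have x: "norm x < 1" using z by (simp add: x_def norm_qpar_less_1)
  have "(\<lambda>n. \<i> * ((1 + x ^ n) / (1 - x ^ n))) \<longlonglongrightarrow> \<i> * ((1 + 0) / (1 - 0))"
    by (intro tendsto_intros LIMSEQ_power_zero x) auto
  moreover have "\<forall>\<^sub>F n in sequentially. \<i> * ((1 + x ^ n) / (1 - x ^ n)) = cot (of_real pi * (of_nat n * z))"
  \<comment> \<open>At n = 0 the denominator 1 - x^n is 0, so the identity is claimed from n = 1
    on.\<close>
  proof (rule eventually_sequentiallyI[of 1])
    fix n :: nat assume n: "n \<ge> 1"
    define u where "u = exp (\<i> * (of_real pi * (of_nat n * z)))"
    have u: "u \<noteq> 0" by (simp add: u_def)
    have "x ^ n = qpar (of_nat n * (- z))" by (simp only: x_def qpar_of_nat_mult)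
    also have "\<dots> = inverse u ^ 2"
      by (simp add: qpar_def u_def power2_eq_square algebra_simps flip: exp_add exp_minus)
    finally have xn: "x ^ n = 1 / u ^ 2" by (simp add: field_simps)
    have "norm (x ^ n) < 1" using x n by (simp add: norm_power power_less_one_iff)
    hence u2: "u ^ 2 \<noteq> 1" by (auto simp: xn)
    have s: "sin (of_real pi * (of_nat n * z)) = (u - 1 / u) / (2 * \<i>)"
      by (simp add: sin_exp_eq u_def exp_minus inverse_eq_divide)
    have c: "cos (of_real pi * (of_nat n * z)) = (u + 1 / u) / 2"
      by (simp add: cos_exp_eq u_def exp_minus inverse_eq_divide)
    show "\<i> * ((1 + x ^ n) / (1 - x ^ n)) = cot (of_real pi * (of_nat n * z))"
      unfolding cot_def s c xn using u u2 by (simp add: divide_simps power2_eq_square) (simp add: algebra_simps)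
  qed
  ultimately show ?thesis by (simp add: tendsto_cong)
qed

lemma has_sum_symmetric_nonzero:
  assumes "(f has_sum S) (UNIV - {0 :: int})"
  shows "(\<lambda>M. \<Sum>k=1..M. f (int k) + f (- int k)) \<longlonglongrightarrow> S"
proof -
  have "((\<lambda>n. if n = 0 then 0 else f n) has_sum S) UNIV"
    using assms by (subst has_sum_cong_neutral[where T = "UNIV - {0}"]) auto
  from has_sum_int_symmetric_limit[OF this]
  have "(\<lambda>M. \<Sum>k=1..M. (if int k = 0 then 0 else f (int k)) + (if - int k = 0 then 0 else f (- int k))) \<longlonglongrightarrow> S"
    by (simp add: sum_symmetric_int)
  also have "(\<lambda>M. \<Sum>k=1..M. (if int k = 0 then 0 else f (int k)) + (if - int k = 0 then 0 else f (- int k)))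
     = (\<lambda>M. \<Sum>k=1..M. f (int k) + f (- int k))"
    by (intro ext sum.cong) auto
  finally show ?thesis .
qed

lemma inverse_squares_limit: "(\<lambda>M. \<Sum>k=1..M. 1 / of_nat k ^ 2 :: complex) \<longlonglongrightarrow> of_real pi ^ 2 / 6"
proof -
  have "(\<lambda>M. \<Sum>n<M. 1 / real ((n + 1)\<^sup>2)) \<longlonglongrightarrow> pi\<^sup>2 / 6"
    using inverse_squares_sums by (simp add: sums_def)
  hence "(\<lambda>M. of_real (\<Sum>n<M. 1 / real ((n + 1)\<^sup>2)) :: complex) \<longlonglongrightarrow> of_real (pi\<^sup>2 / 6)"
    by (rule tendsto_of_real)
  also have "(\<lambda>M. of_real (\<Sum>n<M. 1 / real ((n + 1)\<^sup>2)) :: complex) = (\<lambda>M. \<Sum>k=1..M. 1 / of_nat k ^ 2)"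
  proof
    fix M :: nat
    have "(\<Sum>n<M. 1 / (of_nat (n + 1) :: complex) ^ 2) = (\<Sum>k=1..M. 1 / of_nat k ^ 2)"
      by (rule sum.reindex_bij_witness[of _ "\<lambda>k. k - 1" Suc]) auto
    thus "of_real (\<Sum>n<M. 1 / real ((n + 1)\<^sup>2)) = (\<Sum>k=1..M. 1 / (of_nat k :: complex) ^ 2)" by simp
  qed
  finally show ?thesis by simp
qed

lemma E2_partial_sums:
  assumes \<tau>: "Im \<tau> > 0"
  shows "(\<lambda>M. \<Sum>k=1..M. of_real pi ^ 2 / sin (of_real pi * (of_nat k * \<tau>)) ^ 2)
           \<longlonglongrightarrow> of_real pi ^ 2 / 6 * (E2 \<tau> - 1)"
proof -
  have "filterlim (\<lambda>M::nat. {1..M}) (finite_subsets_at_top {1..}) sequentially"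
  proof (subst filterlim_finite_subsets_at_top, safe)
    fix X :: "nat set" assume X: "finite X" "X \<subseteq> {1..}"
    show "\<forall>\<^sub>F M in sequentially. finite {1..M} \<and> X \<subseteq> {1..M} \<and> {1..M} \<subseteq> {1..}"
      by (rule eventually_sequentiallyI[of "Max (insert 0 X)"]) (use X in \<open>auto simp: Max_ge_iff\<close>)
  qed
  with has_sum_inverse_sin_squared_E2[OF \<tau>] show ?thesis
    unfolding has_sum_def by (rule filterlim_compose[of "sum _"])
qed

text \<open>
  Eisenstein's convergence trick: the double series for \<open>E2\<close> is only conditionally convergent, but
  subtracting a telescoping term makes it absolutely convergent. The row sums then do not see the
  telescoping term, whereas the column sums leave the boundary term \<open>2\<pi>\<i>/\<tau>\<close>.
\<close>

lemma E2_minus_inverse: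
  assumes \<tau>: "Im \<tau> > 0"
  shows "E2 (- 1 / \<tau>) = \<tau> ^ 2 * E2 \<tau> - 6 * \<i> * \<tau> / of_real pi"
proof -
  define A where "A = (\<lambda>(n::int, m::int). 1 / (of_int m + of_int n * \<tau>) ^ 2 -
            (1 / (of_int (m - 1) + of_int n * \<tau>) - 1 / (of_int m + of_int n * \<tau>)))"
  define p :: complex where "p = of_real pi"
  have t0: "\<tau> \<noteq> 0" and p0: "p \<noteq> 0" using \<tau> by (auto simp: p_def)
  have sm: "A summable_on ((UNIV - {0}) \<times> UNIV)" unfolding A_def by (rule Eisenstein_summable[OF \<tau>])
  then obtain T where T: "(A has_sum T) ((UNIV - {0}) \<times> UNIV)" by (auto simp: summable_on_def)

  have row: "((\<lambda>m. A (n, m)) has_sum (p ^ 2 / sin (p * (of_int n * \<tau>)) ^ 2)) UNIV"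
    if "n \<in> UNIV - {0}" for n
  proof -
    define w where "w = of_int n * \<tau>"
    have w: "w \<notin> \<int>" using that \<tau> by (intro not_Ints_if_Im_nonzero) (auto simp: w_def)
    have 1: "((\<lambda>m. 1 / (of_int m + w) ^ 2) has_sum (p ^ 2 / sin (p * w) ^ 2)) UNIV"
      using has_sum_shifted_inverse_squares[OF w] by (simp add: p_def add.commute)
    have 2: "(\<lambda>m. A (n, m)) summable_on UNIV"
      using summable_on_SigmaD1[of "\<lambda>n m. A (n, m)", of "UNIV - {0}" "\<lambda>_. UNIV" n] sm that by (simp add: case_prod_eta)
    \<comment> \<open>As a difference of summable families the telescoping part is summable, so its
      sum \<open>L\<close> may be computed along symmetric ranges.\<close>
    have "(\<lambda>m. 1 / (of_int m + w) ^ 2 + - A (n, m)) summable_on UNIV"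
      using 1 2 by (intro summable_on_add) (auto simp: summable_on_def intro: has_sum_uminusI)
    then obtain L where L: "((\<lambda>m. 1 / (of_int m + w) ^ 2 - A (n, m)) has_sum L) UNIV"
      by (auto simp: summable_on_def)
    have Aeq: "1 / (of_int m + w) ^ 2 - A (n, m) = 1 / (of_int (m - 1) + w) - 1 / (of_int m + w)" for m
      by (simp add: A_def w_def)
    have "(\<lambda>M. 1 / (of_int (- int M - 1) + w) - 1 / (of_int (int M) + w)) \<longlonglongrightarrow> L"
      using has_sum_int_symmetric_limit[OF L] unfolding Aeq
      by (subst (asm) sum_symmetric_int_telescope[of "\<lambda>m. 1 / (of_int m + w)"])
    moreover have "(\<lambda>M. 1 / (of_int (- int M - 1) + w) - 1 / (of_int (int M) + w)) \<longlonglongrightarrow> 0 - 0"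
    proof (intro tendsto_diff)
      have "(\<lambda>M. inverse (of_nat M + w)) \<longlonglongrightarrow> 0"
        by (rule filterlim_compose[OF tendsto_inverse_0])
           (intro tendsto_add_filterlim_at_infinity'[OF _ tendsto_const] tendsto_of_nat)
      thus "(\<lambda>M. 1 / (of_int (int M) + w)) \<longlonglongrightarrow> 0" by (simp add: inverse_eq_divide)
      have "(\<lambda>M. inverse (of_nat M + (1 - w))) \<longlonglongrightarrow> 0"
        by (rule filterlim_compose[OF tendsto_inverse_0])
           (intro tendsto_add_filterlim_at_infinity'[OF _ tendsto_const] tendsto_of_nat)
      hence "(\<lambda>M. - inverse (of_nat M + (1 - w))) \<longlonglongrightarrow> - 0" by (rule tendsto_minus)
      also have "(\<lambda>M. - inverse (of_nat M + (1 - w))) = (\<lambda>M. 1 / (of_int (- int M - 1) + w))"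
      proof
        fix M
        have "of_int (- int M - 1) + w = - (of_nat M + (1 - w))" by simp
        thus "- inverse (of_nat M + (1 - w)) = 1 / (of_int (- int M - 1) + w)"
          by (simp only: inverse_eq_divide divide_minus_right) 
      qed
      finally show "(\<lambda>M. 1 / (of_int (- int M - 1) + w)) \<longlonglongrightarrow> 0" by simp
    qed
    ultimately have "L = 0" using LIMSEQ_unique by fastforce
    with has_sum_add[OF 1 has_sum_uminusI[OF L]] show ?thesis by (simp add: w_def)
  qed

  have T_rows: "T = p ^ 2 / 3 * (E2 \<tau> - 1)"
  proof -
    have "((\<lambda>n. p ^ 2 / sin (p * (of_int n * \<tau>)) ^ 2) has_sum T) (UNIV - {0})"
      by (rule has_sum_SigmaD[OF T row])
    from has_sum_symmetric_nonzero[OF this]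
    have "(\<lambda>M. 2 * (\<Sum>k=1..M. p ^ 2 / sin (p * (of_nat k * \<tau>)) ^ 2)) \<longlonglongrightarrow> T"
      by (simp add: sum_distrib_left)
    moreover have "(\<lambda>M. 2 * (\<Sum>k=1..M. p ^ 2 / sin (p * (of_nat k * \<tau>)) ^ 2)) \<longlonglongrightarrow> 2 * (p ^ 2 / 6 * (E2 \<tau> - 1))"
      unfolding p_def by (intro tendsto_mult tendsto_const E2_partial_sums \<tau>)
    ultimately show ?thesis using LIMSEQ_unique by fastforce
  qed

  \<comment> \<open>\<open>c m\<close> and \<open>b m\<close> are the sums over n \<noteq> 0 of 1/(m
    + n\<tau>)^2 and, in symmetric order, of 1/(m + n\<tau>). For m \<noteq> 0 the term n = 0 has
    been subtracted; for m = 0 the first is 2 zeta(2)/\<tau>^2 and the second is 0 by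
    oddness.\<close>
  define c where "c = (\<lambda>m::int. if m = 0 then p ^ 2 / (3 * \<tau> ^ 2)
     else p ^ 2 / (\<tau> ^ 2 * sin (p * (of_int m / \<tau>)) ^ 2) - 1 / of_int m ^ 2)"
  define b where "b = (\<lambda>m::int. if m = 0 then 0 else p / \<tau> * cot (p * (of_int m / \<tau>)) - 1 / of_int m)"
  have not_int: "of_int m / \<tau> \<notin> \<int>" if "m \<noteq> 0" for m
    using that \<tau> t0 by (intro not_Ints_if_Im_nonzero) (auto simp: Im_divide sum_power2_eq_zero_iff)
  have shift: "of_int m + of_int n * \<tau> = \<tau> * (of_int m / \<tau> + of_int n)" for m n
    using t0 by (simp add: field_simps)
  have c_lim: "(\<lambda>K. \<Sum>k=1..K. 1 / (of_int m + of_int (int k) * \<tau>) ^ 2 + 1 / (of_int m + of_int (- int k) * \<tau>) ^ 2)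
      \<longlonglongrightarrow> c m" for m
  proof (cases "m = 0")
    case True
    have "(\<lambda>K. 2 / \<tau> ^ 2 * (\<Sum>k=1..K. 1 / of_nat k ^ 2)) \<longlonglongrightarrow> 2 / \<tau> ^ 2 * (of_real pi ^ 2 / 6)"
      by (intro tendsto_mult tendsto_const inverse_squares_limit)
    also have "2 / \<tau> ^ 2 * (of_real pi ^ 2 / 6) = c m" by (simp add: c_def p_def True)
    finally show ?thesis by (simp add: True sum_distrib_left power_mult_distrib mult_ac)
  next
    case False
    define z where "z = of_int m / \<tau>"
    have "((\<lambda>n. 1 / \<tau> ^ 2 * (1 / (z + of_int n) ^ 2)) has_sum (1 / \<tau> ^ 2 * (p ^ 2 / sin (p * z) ^ 2))) UNIV"
      unfolding z_def p_def by (intro has_sum_cmult_right has_sum_shifted_inverse_squares not_int False)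
    from has_sum_int_symmetric_limit[OF this]
    have "(\<lambda>K. \<Sum>n\<in>{-int K..int K}. 1 / (of_int m + of_int n * \<tau>) ^ 2) \<longlonglongrightarrow> p ^ 2 / (\<tau> ^ 2 * sin (p * z) ^ 2)"
      unfolding shift z_def by (simp add: power_mult_distrib mult_ac)
    hence "(\<lambda>K. 1 / of_int m ^ 2 + (\<Sum>k=1..K. 1 / (of_int m + of_int (int k) * \<tau>) ^ 2 + 1 / (of_int m + of_int (- int k) * \<tau>) ^ 2))
      \<longlonglongrightarrow> p ^ 2 / (\<tau> ^ 2 * sin (p * z) ^ 2)"
      unfolding sum_symmetric_int by simp
    from tendsto_diff[OF this tendsto_const[of "1 / of_int m ^ 2"]] False show ?thesis by (simp add: c_def z_def)
  qed
  have b_lim: "(\<lambda>K. \<Sum>k=1..K. 1 / (of_int m + of_int (int k) * \<tau>) + 1 / (of_int m + of_int (- int k) * \<tau>))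
      \<longlonglongrightarrow> b m" for m
  proof (cases "m = 0")
    case False
    define z where "z = of_int m / \<tau>"
    have "(\<lambda>K. 1 / \<tau> * (\<Sum>n\<in>{-int K..int K}. 1 / (z + of_int n))) \<longlonglongrightarrow> 1 / \<tau> * (p * cot (p * z))"
      unfolding z_def p_def by (intro tendsto_mult tendsto_const cot_symmetric_limit not_int False)
    hence "(\<lambda>K. \<Sum>n\<in>{-int K..int K}. 1 / (of_int m + of_int n * \<tau>)) \<longlonglongrightarrow> p / \<tau> * cot (p * z)"
      unfolding shift z_def by (simp add: sum_distrib_left)
    hence "(\<lambda>K. 1 / of_int m + (\<Sum>k=1..K. 1 / (of_int m + of_int (int k) * \<tau>) + 1 / (of_int m + of_int (- int k) * \<tau>)))
      \<longlonglongrightarrow> p / \<tau> * cot (p * z)"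
      unfolding sum_symmetric_int by simp
    from tendsto_diff[OF this tendsto_const[of "1 / of_int m"]] False show ?thesis by (simp add: b_def z_def)
  qed (simp add: b_def)

  have col: "((\<lambda>n. A (n, m)) has_sum (c m - (b (m - 1) - b m))) (UNIV - {0})" for m
  proof -
    have "(\<lambda>(m, n). A (n, m)) summable_on (UNIV \<times> (UNIV - {0}))"
      using T by (subst (asm) has_sum_swap) (auto simp: summable_on_def)
    hence "(\<lambda>n. A (n, m)) summable_on (UNIV - {0})"
      using summable_on_SigmaD1[of "\<lambda>m n. A (n, m)", of UNIV "\<lambda>_. UNIV - {0}" m] by simp
    then obtain S where S: "((\<lambda>n. A (n, m)) has_sum S) (UNIV - {0})" by (auto simp: summable_on_def)
    have "(\<lambda>K. (\<Sum>k=1..K. 1 / (of_int m + of_int (int k) * \<tau>) ^ 2 + 1 / (of_int m + of_int (- int k) * \<tau>) ^ 2)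
       - ((\<Sum>k=1..K. 1 / (of_int (m - 1) + of_int (int k) * \<tau>) + 1 / (of_int (m - 1) + of_int (- int k) * \<tau>))
       - (\<Sum>k=1..K. 1 / (of_int m + of_int (int k) * \<tau>) + 1 / (of_int m + of_int (- int k) * \<tau>))))
       \<longlonglongrightarrow> c m - (b (m - 1) - b m)"
      by (intro tendsto_diff c_lim b_lim)
    moreover have "(\<lambda>K. (\<Sum>k=1..K. 1 / (of_int m + of_int (int k) * \<tau>) ^ 2 + 1 / (of_int m + of_int (- int k) * \<tau>) ^ 2)
       - ((\<Sum>k=1..K. 1 / (of_int (m - 1) + of_int (int k) * \<tau>) + 1 / (of_int (m - 1) + of_int (- int k) * \<tau>))
       - (\<Sum>k=1..K. 1 / (of_int m + of_int (int k) * \<tau>) + 1 / (of_int m + of_int (- int k) * \<tau>))))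
       \<longlonglongrightarrow> S"
      using has_sum_symmetric_nonzero[OF S] unfolding A_def case_prod_conv
      by (simp only: sum_subtractf sum.distrib) (simp only: algebra_simps)
    ultimately show ?thesis using S LIMSEQ_unique by fastforce
  qed
  have "((\<lambda>m. c m - (b (m - 1) - b m)) has_sum T) UNIV"
    using T by (subst (asm) has_sum_swap) (rule has_sum_SigmaD, use col in auto)
  from has_sum_int_symmetric_limit[OF this]
  have "(\<lambda>M. (\<Sum>m\<in>{-int M..int M}. c m) - (b (- int M - 1) - b (int M))) \<longlonglongrightarrow> T"
    by (simp only: sum_subtractf[of c] sum_symmetric_int_telescope[of b])
  \<comment> \<open>Since b is odd, the two ends of the telescoping sum add instead of cancelling;
    each tends to pi i/\<tau>.\<close>
  moreover have "b (- int M - 1) = - b (int (Suc M))" for M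
  proof -
    have "b (- m) = - b m" for m by (simp add: b_def cot_def)
    moreover have "- int M - 1 = - int (Suc M)" by simp
    ultimately show ?thesis by metis
  qed
  ultimately have T1: "(\<lambda>M. (\<Sum>m\<in>{-int M..int M}. c m) + (b (int (Suc M)) + b (int M))) \<longlonglongrightarrow> T"
    by (simp add: algebra_simps)
  have "Im (1 / \<tau>) < 0" using Im_minus_inverse_pos[OF \<tau>] by simp
  have "(\<lambda>M. p / \<tau> * cot (p * (of_nat M * (1 / \<tau>))) - 1 / of_nat M) \<longlonglongrightarrow> p / \<tau> * \<i> - 0"
    unfolding p_def by (intro tendsto_intros cot_limit_lower \<open>Im (1 / \<tau>) < 0\<close> lim_1_over_n)
  moreover have "\<forall>\<^sub>F M in sequentially. p / \<tau> * cot (p * (of_nat M * (1 / \<tau>))) - 1 / of_nat M = b (int M)"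
    by (rule eventually_sequentiallyI[of 1]) (auto simp: b_def)
  ultimately have b_infty: "(\<lambda>M. b (int M)) \<longlonglongrightarrow> p / \<tau> * \<i>" by (simp add: tendsto_cong)
  have c_infty: "(\<lambda>M. (\<Sum>m\<in>{-int M..int M}. c m)) \<longlonglongrightarrow>
      p ^ 2 / (3 * \<tau> ^ 2) + (2 / \<tau> ^ 2 * (p ^ 2 / 6 * (E2 (- 1 / \<tau>) - 1)) - 2 * (p ^ 2 / 6))"
  proof -
    have eq: "(\<Sum>m\<in>{-int M..int M}. c m) = p ^ 2 / (3 * \<tau> ^ 2) +
      (2 / \<tau> ^ 2 * (\<Sum>k=1..M. p ^ 2 / sin (p * (of_nat k * (- 1 / \<tau>))) ^ 2) - 2 * (\<Sum>k=1..M. 1 / of_nat k ^ 2))" for M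
    proof -
      have "(\<Sum>k=1..M. c (int k) + c (- int k)) =
        (\<Sum>k=1..M. 2 / \<tau> ^ 2 * (p ^ 2 / sin (p * (of_nat k * (- 1 / \<tau>))) ^ 2) - 2 * (1 / of_nat k ^ 2))"
        by (intro sum.cong) (auto simp: c_def)
      thus ?thesis unfolding sum_symmetric_int by (simp add: sum_subtractf sum_distrib_left c_def)
    qed
    show ?thesis unfolding eq unfolding p_def
      by (intro tendsto_intros inverse_squares_limit E2_partial_sums Im_minus_inverse_pos \<tau>)
  qed
  have "T = p ^ 2 / (3 * \<tau> ^ 2) + (2 / \<tau> ^ 2 * (p ^ 2 / 6 * (E2 (- 1 / \<tau>) - 1)) - 2 * (p ^ 2 / 6))
     + (p / \<tau> * \<i> + p / \<tau> * \<i>)"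
    by (rule LIMSEQ_unique[OF T1]) (intro tendsto_add c_infty b_infty LIMSEQ_Suc[OF b_infty])
  hence "p ^ 2 / 3 * (E2 \<tau> - 1) = p ^ 2 / (3 * \<tau> ^ 2) + (2 / \<tau> ^ 2 * (p ^ 2 / 6 * (E2 (- 1 / \<tau>) - 1)) - 2 * (p ^ 2 / 6))
     + (p / \<tau> * \<i> + p / \<tau> * \<i>)" by (simp only: T_rows)
  hence "18 * \<tau> ^ 2 * p ^ 2 * E2 \<tau> = 108 * \<i> * \<tau> * p + 18 * p ^ 2 * E2 (- 1 / \<tau>)"
    using t0 by (simp add: field_simps power2_eq_square)
  hence "p * (E2 (- 1 / \<tau>) * p - ((\<tau> ^ 2 * E2 \<tau>) * p - 6 * \<i> * \<tau>)) = 0" by algebra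
  hence "E2 (- 1 / \<tau>) * p = (\<tau> ^ 2 * E2 \<tau>) * p - 6 * \<i> * \<tau>"
    using p0 by (simp only: mult_eq_0_iff right_minus_eq simp_thms)
  thus ?thesis using p0 by (simp add: field_simps p_def)
qed

section \<open>The forms E4 and E6\<close>

text \<open>The k-th iterate of q d/dq on the generating function of \<open>sigma1\<close>, so that
  derivatives stay within one family.\<close>

definition sigma1_series :: "nat \<Rightarrow> complex \<Rightarrow> complex" where
  "sigma1_series k q = (\<Sum>n. of_nat (n ^ k * sigma1 n) * q ^ n)"

text \<open>Termwise differentiation followed by multiplication by q preserves convergence in the
  unit disc and raises k by one.\<close>

lemma summable_sigma1_series:
  assumes "norm q < 1"
  shows "summable (\<lambda>n. of_nat (n ^ k * sigma1 n) * q ^ n :: complex)"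
  using assms
proof (induction k arbitrary: q)
  case 0
  obtain S where "((\<lambda>n. of_nat (sigma1 n) * q ^ n) has_sum S) {1..}"
    using has_sum_Lambert_sigma1[of q] 0 by blast
  hence "((\<lambda>n. of_nat (sigma1 n) * q ^ n) has_sum S) UNIV"
    by (subst (asm) has_sum_cong_neutral[where T = UNIV]) (auto simp: Suc_le_eq)
  from has_sum_imp_sums[OF this] show ?case by (simp add: sums_iff)
next
  case (Suc k)
  have "summable (\<lambda>n. diffs (\<lambda>n. of_nat (n ^ k * sigma1 n)) n * q ^ n)"
    by (rule termdiff_converges[OF Suc.prems Suc.IH])
  hence "summable (\<lambda>n. q * (diffs (\<lambda>n. of_nat (n ^ k * sigma1 n)) n * q ^ n))"
    by (rule summable_mult)
  also have "(\<lambda>n. q * (diffs (\<lambda>n. of_nat (n ^ k * sigma1 n)) n * q ^ n)) =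
     (\<lambda>n. of_nat (Suc n ^ Suc k * sigma1 (Suc n)) * q ^ Suc n)"
    by (simp add: diffs_def algebra_simps)
  finally show ?case by (subst (asm) summable_Suc_iff)
qed

lemma sigma1_series_has_field_derivative:
  assumes q: "norm q < 1" "q \<noteq> 0"
  shows "(sigma1_series k has_field_derivative sigma1_series (Suc k) q / q) (at q)"
proof -
  let ?d = "\<lambda>n. diffs (\<lambda>n. of_nat (n ^ k * sigma1 n) :: complex) n * q ^ n"
  have "(\<lambda>n. of_nat (n ^ Suc k * sigma1 n) * q ^ n) sums sigma1_series (Suc k) q"
    unfolding sigma1_series_def by (rule summable_sums[OF summable_sigma1_series[OF q(1)]])
  hence "(\<lambda>n. of_nat (Suc n ^ Suc k * sigma1 (Suc n)) * q ^ Suc n) sums sigma1_series (Suc k) q"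
    by (subst sums_Suc_iff) simp
  also have "(\<lambda>n. of_nat (Suc n ^ Suc k * sigma1 (Suc n)) * q ^ Suc n) = (\<lambda>n. ?d n * q)"
    by (simp add: diffs_def algebra_simps)
  finally have "(\<lambda>n. ?d n * q / q) sums (sigma1_series (Suc k) q / q)"
    by (rule sums_divide)
  hence "(\<Sum>n. ?d n) = sigma1_series (Suc k) q / q" using q by (simp add: sums_iff)
  moreover have "((\<lambda>q. \<Sum>n. of_nat (n ^ k * sigma1 n) * q ^ n) has_field_derivative (\<Sum>n. ?d n)) (at q)"
    by (rule termdiffs_strong'[OF summable_sigma1_series q(1)])
  ultimately show ?thesis by (simp add: sigma1_series_def[abs_def])
qed

abbreviation UHP :: "complex set" where "UHP \<equiv> {\<tau>. Im \<tau> > 0}"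

lemma open_UHP: "open UHP"
  by (rule open_halfspace_Im_gt)

lemma qpar_nonzero [simp]: "qpar \<tau> \<noteq> 0"
  by (simp add: qpar_def)

lemma qpar_has_field_derivative [derivative_intros]:
  "(qpar has_field_derivative 2 * of_real pi * \<i> * qpar \<tau>) (at \<tau>)"
  unfolding qpar_def[abs_def] by (auto intro!: derivative_eq_intros)

definition Dsig :: "nat \<Rightarrow> complex \<Rightarrow> complex" where
  "Dsig k \<tau> = sigma1_series k (qpar \<tau>)"

lemma Dsig_has_field_derivative:
  assumes "Im \<tau> > 0"
  shows "(Dsig k has_field_derivative 2 * of_real pi * \<i> * Dsig (Suc k) \<tau>) (at \<tau>)"
  unfolding Dsig_def[abs_def]
  using DERIV_chain2[OF sigma1_series_has_field_derivative[OF norm_qpar_less_1[OF assms] qpar_nonzero]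
      qpar_has_field_derivative] by (simp add: mult_ac)

lemma Dsig_holomorphic [holomorphic_intros]: "Dsig k holomorphic_on UHP"
  by (rule holomorphic_on_subset[of _ UHP])
     (auto simp: holomorphic_on_open open_UHP intro: Dsig_has_field_derivative)

lemma Dsig_periodic: "Dsig k (\<tau> + of_int n) = Dsig k \<tau>"
  by (simp add: Dsig_def qpar_add)

lemma E2_eq_Dsig: "E2 \<tau> = 1 - 24 * Dsig 0 \<tau>"
  by (simp add: E2_eq_suminf Dsig_def sigma1_series_def)

text \<open>
  With \<open>D = q d/dq\<close> we have \<open>D\<^sup>k E2 = -24 Dsig k\<close> for \<open>k \<ge> 1\<close>, so by Ramanujan's identities the forms below are
  \<open>E4 = E2\<^sup>2 - 12 D E2\<close> and \<open>E6 = E2\<^sup>3 - 18 E2 (D E2) + 36 D\<^sup>2 E2\<close>.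
\<close>

definition E4 :: "complex \<Rightarrow> complex" where
  "E4 \<tau> = E2 \<tau> ^ 2 + 288 * Dsig 1 \<tau>"

definition E6 :: "complex \<Rightarrow> complex" where
  "E6 \<tau> = E2 \<tau> ^ 3 + 432 * E2 \<tau> * Dsig 1 \<tau> - 864 * Dsig 2 \<tau>"

lemma E2_holomorphic [holomorphic_intros]: "E2 holomorphic_on UHP"
  unfolding E2_eq_Dsig[abs_def] by (intro holomorphic_intros)

lemma E4_holomorphic: "E4 holomorphic_on UHP"
  unfolding E4_def[abs_def] by (intro holomorphic_intros)

lemma E6_holomorphic: "E6 holomorphic_on UHP"
  unfolding E6_def[abs_def] by (intro holomorphic_intros)

lemma E2_periodic: "E2 (\<tau> + of_int n) = E2 \<tau>"
  by (simp add: E2_eq_Dsig Dsig_periodic)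

lemma E4_periodic: "E4 (\<tau> + of_int n) = E4 \<tau>"
  by (simp add: E4_def E2_periodic Dsig_periodic)

lemma E6_periodic: "E6 (\<tau> + of_int n) = E6 \<tau>"
  by (simp add: E6_def E2_periodic Dsig_periodic)

text \<open>Each law is the derivative of the previous one: both expressions for the function at
  -1/\<tau> are differentiated and compared. The constant d = 1/(2 pi i) undoes the factor of
  d/d\<tau> = 2 pi i q d/dq, and 12 d \<tau> is the term -6 i \<tau> / pi.\<close>

lemma
  assumes \<tau>: "Im \<tau> > 0"
  defines "d \<equiv> 1 / (2 * of_real pi * \<i>)"
  shows E2_S: "E2 (- 1 / \<tau>) = \<tau> ^ 2 * E2 \<tau> + 12 * d * \<tau>"
    and Dsig_1_S: "24 * Dsig 1 (- 1 / \<tau>) = 24 * \<tau> ^ 4 * Dsig 1 \<tau> - 2 * d * \<tau> ^ 3 * E2 \<tau> - 12 * d ^ 2 * \<tau> ^ 2"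
    and Dsig_2_S: "24 * Dsig 2 (- 1 / \<tau>) = 24 * \<tau> ^ 6 * Dsig 2 \<tau> + 144 * d * \<tau> ^ 5 * Dsig 1 \<tau>
                     - 6 * d ^ 2 * \<tau> ^ 4 * E2 \<tau> - 24 * d ^ 3 * \<tau> ^ 3"
proof -
  define e where "e = 2 * of_real pi * \<i>"
  have e0: "e \<noteq> 0" and ed: "e * d = 1" by (auto simp: e_def d_def)
  have E2: "E2 (- 1 / \<tau>) = \<tau> ^ 2 * E2 \<tau> + 12 * d * \<tau>" if "Im \<tau> > 0" for \<tau>
  proof -
    have "12 * d * \<tau> = - (6 * \<i> * \<tau> / of_real pi)"
      by (simp add: d_def divide_simps)
    thus ?thesis using E2_minus_inverse[OF that] by simp
  qed
  have dD: "(Dsig k has_field_derivative e * Dsig (Suc k) \<tau>) (at \<tau>)" if "Im \<tau> > 0" for \<tau> k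
    using Dsig_has_field_derivative[OF that] by (simp add: e_def)
  have inv: "((\<lambda>\<tau>. - 1 / \<tau>) has_field_derivative 1 / \<tau> ^ 2) (at \<tau>)" if "Im \<tau> > 0" for \<tau> :: complex
  proof -
    have "\<tau> \<noteq> 0" using that by auto
    thus ?thesis by (auto intro!: derivative_eq_intros simp: power2_eq_square)
  qed
  have dDS: "((\<lambda>\<tau>. Dsig k (- 1 / \<tau>)) has_field_derivative e * Dsig (Suc k) (- 1 / \<tau>) * (1 / \<tau> ^ 2)) (at \<tau>)"
    if "Im \<tau> > 0" for \<tau> k
    by (rule DERIV_chain2[OF dD inv]) (use that Im_minus_inverse_pos in auto)
  have dE2: "(E2 has_field_derivative - 24 * (e * Dsig 1 \<tau>)) (at \<tau>)" if "Im \<tau> > 0" for \<tau>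
    unfolding E2_eq_Dsig[abs_def] using dD[OF that, of 0] by (auto intro!: derivative_eq_intros)
  have D1: "24 * Dsig 1 (- 1 / \<tau>) = 24 * \<tau> ^ 4 * Dsig 1 \<tau> - 2 * d * \<tau> ^ 3 * E2 \<tau> - 12 * d ^ 2 * \<tau> ^ 2"
    if \<tau>: "Im \<tau> > 0" for \<tau>
  proof -
    have t0: "\<tau> \<noteq> 0" using that by auto
    have 1: "((\<lambda>\<tau>. E2 (- 1 / \<tau>)) has_field_derivative - 24 * (e * Dsig 1 (- 1 / \<tau>) * (1 / \<tau> ^ 2))) (at \<tau>)"
      unfolding E2_eq_Dsig using dDS[OF \<tau>, of 0] by (auto intro!: derivative_eq_intros)
    have "((\<lambda>\<tau>. \<tau> ^ 2 * E2 \<tau> + 12 * d * \<tau>) has_field_derivative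
       2 * \<tau> * E2 \<tau> + \<tau> ^ 2 * (- 24 * (e * Dsig 1 \<tau>)) + 12 * d) (at \<tau>)"
      using dE2[OF \<tau>] by (auto intro!: derivative_eq_intros simp: mult_ac)
    hence "((\<lambda>\<tau>. E2 (- 1 / \<tau>)) has_field_derivative
       2 * \<tau> * E2 \<tau> + \<tau> ^ 2 * (- 24 * (e * Dsig 1 \<tau>)) + 12 * d) (at \<tau>)"
      by (rule has_field_derivative_transform_within_open[OF _ open_UHP]) (use \<tau> E2 in auto)
    from DERIV_unique[OF 1 this]
    have "24 * (e * Dsig 1 (- 1 / \<tau>)) = \<tau> ^ 2 * (24 * \<tau> ^ 2 * (e * Dsig 1 \<tau>) - 2 * \<tau> * E2 \<tau> - 12 * d)"
      using t0 by (simp add: field_simps)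
    from arg_cong[OF this, of "\<lambda>x. d * x"] ed show ?thesis by algebra
  qed
  have D2: "24 * Dsig 2 (- 1 / \<tau>) = 24 * \<tau> ^ 6 * Dsig 2 \<tau> + 144 * d * \<tau> ^ 5 * Dsig 1 \<tau>
                     - 6 * d ^ 2 * \<tau> ^ 4 * E2 \<tau> - 24 * d ^ 3 * \<tau> ^ 3"
    if \<tau>: "Im \<tau> > 0" for \<tau>
  proof -
    have t0: "\<tau> \<noteq> 0" using that by auto
    have 1: "((\<lambda>\<tau>. 24 * Dsig 1 (- 1 / \<tau>)) has_field_derivative 24 * (e * Dsig 2 (- 1 / \<tau>) * (1 / \<tau> ^ 2))) (at \<tau>)"
      using dDS[OF \<tau>, of 1] by (auto intro!: derivative_eq_intros simp: numeral_2_eq_2)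
    have "((\<lambda>\<tau>. 24 * \<tau> ^ 4 * Dsig 1 \<tau> - 2 * d * \<tau> ^ 3 * E2 \<tau> - 12 * d ^ 2 * \<tau> ^ 2) has_field_derivative
       96 * \<tau> ^ 3 * Dsig 1 \<tau> + 24 * \<tau> ^ 4 * (e * Dsig 2 \<tau>) - 6 * d * \<tau> ^ 2 * E2 \<tau>
       - 2 * d * \<tau> ^ 3 * (- 24 * (e * Dsig 1 \<tau>)) - 24 * d ^ 2 * \<tau>) (at \<tau>)"
      using dE2[OF \<tau>] dD[OF \<tau>, of 1] by (auto intro!: derivative_eq_intros simp: algebra_simps numeral_2_eq_2)
    hence "((\<lambda>\<tau>. 24 * Dsig 1 (- 1 / \<tau>)) has_field_derivative
       96 * \<tau> ^ 3 * Dsig 1 \<tau> + 24 * \<tau> ^ 4 * (e * Dsig 2 \<tau>) - 6 * d * \<tau> ^ 2 * E2 \<tau>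
       - 2 * d * \<tau> ^ 3 * (- 24 * (e * Dsig 1 \<tau>)) - 24 * d ^ 2 * \<tau>) (at \<tau>)"
      by (rule has_field_derivative_transform_within_open[OF _ open_UHP]) (use \<tau> D1 in auto)
    from DERIV_unique[OF 1 this]
    have "24 * (e * Dsig 2 (- 1 / \<tau>)) = \<tau> ^ 2 * (96 * \<tau> ^ 3 * Dsig 1 \<tau> + 24 * \<tau> ^ 4 * (e * Dsig 2 \<tau>) - 6 * d * \<tau> ^ 2 * E2 \<tau>
       - 2 * d * \<tau> ^ 3 * (- 24 * (e * Dsig 1 \<tau>)) - 24 * d ^ 2 * \<tau>)"
      using t0 by (simp add: field_simps)
    from arg_cong[OF this, of "\<lambda>x. d * x"] ed show ?thesis by algebra
  qed
  show "E2 (- 1 / \<tau>) = \<tau> ^ 2 * E2 \<tau> + 12 * d * \<tau>" by (rule E2[OF \<tau>])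
  show "24 * Dsig 1 (- 1 / \<tau>) = 24 * \<tau> ^ 4 * Dsig 1 \<tau> - 2 * d * \<tau> ^ 3 * E2 \<tau> - 12 * d ^ 2 * \<tau> ^ 2"
    by (rule D1[OF \<tau>])
  show "24 * Dsig 2 (- 1 / \<tau>) = 24 * \<tau> ^ 6 * Dsig 2 \<tau> + 144 * d * \<tau> ^ 5 * Dsig 1 \<tau>
                     - 6 * d ^ 2 * \<tau> ^ 4 * E2 \<tau> - 24 * d ^ 3 * \<tau> ^ 3"
    by (rule D2[OF \<tau>])
qed

text \<open>All terms carrying a power of \<open>d\<close>, which measure the failure of modularity,
  cancel in this combination; likewise for \<open>E6\<close>.\<close>

lemma E4_minus_inverse:
  assumes "Im \<tau> > 0"
  shows "E4 (- 1 / \<tau>) = \<tau> ^ 4 * E4 \<tau>"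
  unfolding E4_def using E2_S[OF assms] Dsig_1_S[OF assms] by algebra

lemma E6_minus_inverse:
  assumes "Im \<tau> > 0"
  shows "E6 (- 1 / \<tau>) = \<tau> ^ 6 * E6 \<tau>"
  unfolding E6_def using E2_S[OF assms] Dsig_1_S[OF assms] Dsig_2_S[OF assms] by algebra

section \<open>Near-linearity of E4 and E6 in the variable q\<close>

lemma sigma1_le: "sigma1 n \<le> n ^ 2"
proof (cases "n = 0")
  case False
  hence "{d. d dvd n} \<subseteq> {1..n}" by (auto simp: Suc_le_eq dvd_imp_le intro: Nat.gr0I)
  hence "sigma1 n \<le> (\<Sum>d\<in>{1..n}. d)" unfolding sigma1_def by (intro sum_mono2) auto
  also have "\<dots> \<le> (\<Sum>d\<in>{1..n}. n)" by (intro sum_mono) auto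
  finally show ?thesis by (simp add: power2_eq_square)
qed simp

lemma norm_power_Suc_diff_le:
  fixes q p :: complex
  assumes "norm q \<le> R" "norm p \<le> R"
  shows "norm (q ^ Suc n - p ^ Suc n) \<le> real (Suc n) * R ^ n * norm (q - p)"
proof (induction n)
  case (Suc n)
  have R: "R \<ge> 0" using assms norm_ge_zero order_trans by blast
  have "q ^ Suc (Suc n) - p ^ Suc (Suc n) = q * (q ^ Suc n - p ^ Suc n) + p ^ Suc n * (q - p)"
    by (simp add: algebra_simps)
  hence "norm (q ^ Suc (Suc n) - p ^ Suc (Suc n))
      \<le> norm q * norm (q ^ Suc n - p ^ Suc n) + norm p ^ Suc n * norm (q - p)"
    by (metis norm_triangle_ineq norm_mult norm_power)
  also have "\<dots> \<le> R * (real (Suc n) * R ^ n * norm (q - p)) + R ^ Suc n * norm (q - p)"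
    using assms R by (intro add_mono mult_mono power_mono Suc) auto
  finally show ?case by (simp add: algebra_simps)
qed simp

text \<open>The fifth power is n^4 from n^k sigma1(n) with k \<le> 2, times n from the difference of
  two n-th powers. The largest ratio of consecutive terms is (3/2)^5 = 243/32 < 8, at n = 0.\<close>

lemma power5_le: "(n + 2) ^ 5 \<le> 32 * 8 ^ n" for n :: nat
proof (induction n)
  case (Suc n)
  have "(2 * (Suc n + 2)) ^ 5 \<le> (3 * (n + 2)) ^ 5" by (intro power_mono) auto
  hence "32 * (Suc n + 2) ^ 5 \<le> 243 * (n + 2) ^ 5" by (simp only: power_mult_distrib) simp
  with Suc show ?case by simp
qed (simp add: eval_nat_numeral)

text \<open>The coefficient of q is 1, and the tail from q^2 on has Lipschitz constant at most
  32R/(1 - 8R) = 16/91 < 9/50 for R = 1/190.\<close>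

lemma sigma1_series_near_linear:
  assumes q: "norm q \<le> 1 / 190" and p: "norm p \<le> 1 / 190" and k: "k \<le> 2"
  shows "norm (sigma1_series k q - sigma1_series k p - (q - p)) \<le> 9 / 50 * norm (q - p)"
proof -
  define c where "c = (\<lambda>n. n ^ k * sigma1 n)"
  define R :: real where "R = 1 / 190"
  have split: "sigma1_series k x = (\<Sum>n. of_nat (c (n + 2)) * x ^ (n + 2)) + x"
    and sm: "summable (\<lambda>n. of_nat (c (n + 2)) * x ^ (n + 2))" if "norm x \<le> 1 / 190" for x :: complex
  proof -
    have s: "summable (\<lambda>n. of_nat (c n) * x ^ n)"
      unfolding c_def using that by (intro summable_sigma1_series) auto
    have "{d. d dvd (1::nat)} = {1}" by auto
    hence "sigma1 1 = 1" by (simp add: sigma1_def)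
    thus "sigma1_series k x = (\<Sum>n. of_nat (c (n + 2)) * x ^ (n + 2)) + x"
      using suminf_split_initial_segment[OF s, of 2] by (simp add: sigma1_series_def c_def numeral_2_eq_2)
    show "summable (\<lambda>n. of_nat (c (n + 2)) * x ^ (n + 2))" using s by (subst summable_iff_shift)
  qed
  have eq: "sigma1_series k q - sigma1_series k p - (q - p) =
      (\<Sum>n. of_nat (c (n + 2)) * (q ^ (n + 2) - p ^ (n + 2)))"
    unfolding split[OF q] split[OF p] using suminf_diff[OF sm[OF q] sm[OF p]] by (simp add: right_diff_distrib)
  have g: "(\<lambda>n. 32 * R * norm (q - p) * (8 * R) ^ n) sums (32 * R * norm (q - p) * (1 / (1 - 8 * R)))"
    by (intro sums_mult geometric_sums) (simp add: R_def)
  have "norm (\<Sum>n. of_nat (c (n + 2)) * (q ^ (n + 2) - p ^ (n + 2))) \<le> (\<Sum>n. 32 * R * norm (q - p) * (8 * R) ^ n)"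
  proof (rule norm_suminf_le)
    fix n
    have "c (n + 2) \<le> (n + 2) ^ 2 * (n + 2) ^ 2"
      unfolding c_def using k by (intro mult_mono sigma1_le power_increasing) auto
    hence "c (n + 2) * (n + 2) \<le> (n + 2) ^ 2 * (n + 2) ^ 2 * (n + 2)" by (rule mult_right_mono) simp
    also have "\<dots> = (n + 2) ^ 5"
    proof -
      have "x ^ 2 * x ^ 2 * x = x ^ 5" for x :: nat by (simp add: eval_nat_numeral)
      thus ?thesis .
    qed
    also have "\<dots> \<le> 32 * 8 ^ n" by (rule power5_le)
    finally have cn: "real (c (n + 2)) * real (n + 2) \<le> 32 * 8 ^ n"
      by (metis (mono_tags, lifting) of_nat_le_iff of_nat_mult of_nat_numeral of_nat_power)
    have "norm (of_nat (c (n + 2)) * (q ^ (n + 2) - p ^ (n + 2)))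
      \<le> real (c (n + 2)) * (real (n + 2) * R ^ (n + 1) * norm (q - p))"
      using norm_power_Suc_diff_le[of q R p "n + 1"] q p
      by (simp add: R_def norm_mult mult_left_mono del: power_Suc)
    also have "\<dots> = (real (c (n + 2)) * real (n + 2)) * (R ^ (n + 1) * norm (q - p))" by simp
    also have "\<dots> \<le> (32 * 8 ^ n) * (R ^ (n + 1) * norm (q - p))"
      using cn by (rule mult_right_mono) (simp add: R_def)
    finally show "norm (of_nat (c (n + 2)) * (q ^ (n + 2) - p ^ (n + 2))) \<le> 32 * R * norm (q - p) * (8 * R) ^ n"
      by (simp add: power_mult_distrib mult_ac)
  qed (use g in \<open>simp add: sums_iff\<close>)
  also have "\<dots> = 32 * R / (1 - 8 * R) * norm (q - p)" using g by (simp add: sums_iff)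
  also have "\<dots> \<le> 9 / 50 * norm (q - p)" by (intro mult_right_mono) (simp_all add: R_def)
  finally show ?thesis unfolding eq .
qed

lemma sigma1_series_0 [simp]: "sigma1_series k 0 = 0"
  unfolding sigma1_series_def by (subst powser_zero) simp

lemma norm_sigma1_series_le:
  assumes q: "norm q \<le> 1 / 190" and k: "k \<le> 2"
  shows "norm (sigma1_series k q) \<le> 59 / 50 * norm q"
proof -
  have "norm (sigma1_series k q - q) \<le> 9 / 50 * norm q"
    using sigma1_series_near_linear[OF q, of 0 k] k by simp
  thus ?thesis using norm_triangle_sub[of "sigma1_series k q" q] by simp
qed

definition E4q :: "complex \<Rightarrow> complex" where
  "E4q q = (1 - 24 * sigma1_series 0 q) ^ 2 + 288 * sigma1_series 1 q"

definition E6q :: "complex \<Rightarrow> complex" where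
  "E6q q = (1 - 24 * sigma1_series 0 q) ^ 3 + 432 * (1 - 24 * sigma1_series 0 q) * sigma1_series 1 q
     - 864 * sigma1_series 2 q"

lemma E4_eq_E4q: "E4 \<tau> = E4q (qpar \<tau>)" and E6_eq_E6q: "E6 \<tau> = E6q (qpar \<tau>)"
  by (simp_all add: E4_def E4q_def E6_def E6q_def E2_eq_Dsig Dsig_def)

lemma norm_mult_le:
  fixes x y :: "'a::real_normed_algebra"
  assumes "norm x \<le> a" "norm y \<le> b"
  shows "norm (x * y) \<le> a * b"
  using assms by (meson mult_mono norm_ge_zero norm_mult_ineq order_trans)

text \<open>The slopes are the q-coefficients 240 = -48 + 288 and -504 = -72 + 432 - 864. The errors
  come to about 69 and 427, before rounding up.\<close>

lemma
  assumes q: "norm q \<le> 1 / 190" and p: "norm p \<le> 1 / 190"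
  shows E4q_near_linear: "norm (E4q q - E4q p - 240 * (q - p)) \<le> 100 * norm (q - p)"
    and E6q_near_linear: "norm (E6q q - E6q p - (-504) * (q - p)) \<le> 450 * norm (q - p)"
proof -
  define N where "N = norm (q - p)"
  have N: "N \<ge> 0" by (simp add: N_def)
  define d where "d = (\<lambda>k. sigma1_series k q - sigma1_series k p - (q - p))"
  define a b where "a = (\<lambda>k. sigma1_series k q)" and "b = (\<lambda>k. sigma1_series k p)"
  have d: "norm (d k) \<le> 9 / 50 * N" if "k \<le> 2" for k
    unfolding d_def N_def by (rule sigma1_series_near_linear[OF q p that])
  \<comment> \<open>59/50 * 1/190 < 1/160.\<close>
  have a: "norm (a k) \<le> 1 / 160" and b: "norm (b k) \<le> 1 / 160" if "k \<le> 2" for k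
    using norm_sigma1_series_le[OF q that] norm_sigma1_series_le[OF p that] q p by (simp_all add: a_def b_def)
  have dd: "norm (q - p + d k) \<le> 59 / 50 * N" if "k \<le> 2" for k
    using norm_triangle_le[of "q - p" "d k" "59 / 50 * N"] d[OF that] by (simp add: N_def)
  have ab: "norm (a 0 + b 0) \<le> 1 / 80"
    using norm_triangle_mono[OF a[of 0] b[of 0]] by simp
  have num: "norm (numeral k * x) \<le> numeral k * c" if "norm x \<le> c" for x :: complex and c k
    using that by (simp add: norm_mult)
  have eq4: "E4q q - E4q p - 240 * (q - p) = 288 * d 1 + 576 * ((a 0 + b 0) * (q - p + d 0)) - 48 * d 0"
    unfolding E4q_def d_def a_def b_def by (simp add: algebra_simps power2_eq_square)
  have "norm (288 * d 1 + 576 * ((a 0 + b 0) * (q - p + d 0)) - 48 * d 0)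
     \<le> 288 * (9 / 50 * N) + 576 * (1 / 80 * (59 / 50 * N)) + 48 * (9 / 50 * N)"
    by (intro norm_triangle_mono norm_triangle_le_diff[OF add_mono] num norm_mult_le d dd ab) auto
  also have "\<dots> \<le> 100 * N" using N by simp
  finally show "norm (E4q q - E4q p - 240 * (q - p)) \<le> 100 * norm (q - p)" unfolding eq4 N_def .
  have eq6: "E6q q - E6q p - (-504) * (q - p) =
     432 * d 1 + 1728 * ((a 0 + b 0) * (q - p + d 0)) - (72 * d 0 + 864 * d 2
     + 13824 * ((a 0 * a 0 + a 0 * b 0 + b 0 * b 0) * (q - p + d 0))
     + 10368 * (a 0 * (q - p + d 1) + b 1 * (q - p + d 0)))"
    unfolding E6q_def d_def a_def b_def by (simp add: algebra_simps power2_eq_square power3_eq_cube)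
  have "norm (432 * d 1 + 1728 * ((a 0 + b 0) * (q - p + d 0)) - (72 * d 0 + 864 * d 2
     + 13824 * ((a 0 * a 0 + a 0 * b 0 + b 0 * b 0) * (q - p + d 0))
     + 10368 * (a 0 * (q - p + d 1) + b 1 * (q - p + d 0))))
    \<le> (432 * (9 / 50 * N) + 1728 * (1 / 80 * (59 / 50 * N))) + (72 * (9 / 50 * N) + 864 * (9 / 50 * N)
     + 13824 * ((1 / 160 * (1 / 160) + 1 / 160 * (1 / 160) + 1 / 160 * (1 / 160)) * (59 / 50 * N))
     + 10368 * (1 / 160 * (59 / 50 * N) + 1 / 160 * (59 / 50 * N)))"
    by (intro norm_triangle_mono norm_triangle_le_diff[OF add_mono] num norm_mult_le a b d dd ab) auto
  also have "\<dots> \<le> 450 * N" using N by simp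
  finally show "norm (E6q q - E6q p - (-504) * (q - p)) \<le> 450 * norm (q - p)" unfolding eq6 N_def .
qed

text \<open>Partial sums of the series of inverse squares bound pi^2/6 from below; 24 terms are
  enough for 3.1.\<close>

lemma pi_gt_31: "pi > 31 / 10"
proof -
  have "(\<Sum>n<24. 1 / real ((n + 1)\<^sup>2)) \<le> pi\<^sup>2 / 6"
    using sum_le_suminf[of "\<lambda>n. 1 / real ((n + 1)\<^sup>2)" "{..<24}"] inverse_squares_sums by (auto simp: sums_iff)
  moreover have "(\<Sum>n<24. 1 / real ((n + 1)\<^sup>2)) > (31 / 10) ^ 2 / 6"
    by (simp add: eval_nat_numeral lessThan_Suc)
  ultimately have "(31 / 10) ^ 2 < pi ^ 2" by simp
  thus ?thesis by (rule power2_less_imp_less) simp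
qed

text \<open>2 * 3.1 * 0.85 = 5.27, and exp 5.27 is bounded below by 2.718^5 times the quadratic
  Taylor polynomial at 0.27, about 193.8.\<close>

lemma norm_qpar_less:
  assumes "Im \<tau> > 17 / 20"
  shows "norm (qpar \<tau>) < 1 / 190"
proof -
  have e: "exp 1 \<ge> (2.718 :: real)" using e_approx_32 unfolding abs_le_iff inverse_eq_divide by simp
  have "2 * pi * Im \<tau> > 2 * (31 / 10) * (17 / 20)"
    using mult_strict_mono[of "31 / 10" pi "17 / 20" "Im \<tau>"] assms pi_gt_31 by simp
  hence y: "2 * pi * Im \<tau> > 5.27" by simp
  have "(190 :: real) < 2.718 ^ 5 * (1 + 0.27 + 0.27 ^ 2 / 2)" by (simp add: eval_nat_numeral)
  also have "\<dots> \<le> exp 1 ^ 5 * exp 0.27"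
    using e by (intro mult_mono power_mono exp_lower_Taylor_quadratic) auto
  also have "\<dots> = exp 5.27" by (simp flip: exp_of_nat_mult exp_add)
  also have "\<dots> \<le> exp (2 * pi * Im \<tau>)" using y by simp
  finally show ?thesis by (simp add: norm_qpar exp_minus inverse_eq_divide divide_strict_left_mono)
qed

section \<open>Zeros of E4 and E6, and forms of weight zero\<close>

lemma qpar_eq_iff: "qpar x = qpar y \<longleftrightarrow> (\<exists>n::int. x = y + of_int n)"
proof -
  have "qpar x = qpar y \<longleftrightarrow> (\<exists>n::int. 2 * of_real pi * \<i> * x = 2 * of_real pi * \<i> * y + (of_int (2 * n) * pi) * \<i>)"
    by (simp add: qpar_def exp_eq)
  also have "\<dots> \<longleftrightarrow> (\<exists>n::int. x = y + of_int n)"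
  proof (intro ex_cong1)
    fix n :: int
    have "2 * of_real pi * \<i> * y + (of_int (2 * n) * pi) * \<i> = 2 * of_real pi * \<i> * (y + of_int n)"
      by (simp add: algebra_simps)
    thus "(2 * of_real pi * \<i> * x = 2 * of_real pi * \<i> * y + (of_int (2 * n) * pi) * \<i>) \<longleftrightarrow> x = y + of_int n"
      by simp
  qed
  finally show ?thesis .
qed

lemma rho_eq: "rho = Complex (- 1 / 2) (sqrt 3 / 2)"
proof -
  have "rho = cis (2 * pi / 3)" unfolding rho_def cis_conv_exp by (rule arg_cong[of _ _ exp]) simp
  moreover have "2 * pi / 3 = pi - pi / 3" by simp
  hence "cos (2 * pi / 3) = - 1 / 2" "sin (2 * pi / 3) = sqrt 3 / 2"
    by (simp_all only: cos_pi_minus sin_pi_minus cos_60 sin_60)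
  ultimately show ?thesis by (simp add: cis.ctr)
qed

lemma rho_poly: "rho ^ 2 + rho + 1 = 0"
  by (simp add: rho_eq complex_eq_iff power2_eq_square)

lemma rho_neq_1: "rho \<noteq> 1"
  by (simp add: rho_eq complex_eq_iff)

lemma minus_inverse_rho: "- 1 / rho = rho + 1"
proof -
  have "rho \<noteq> 0" using rho_poly by auto
  thus ?thesis using rho_poly by (simp add: divide_simps) algebra
qed

lemma Im_rho: "Im rho > 43 / 50"
proof -
  have "sqrt ((86 / 50)\<^sup>2) < sqrt 3" by (rule real_sqrt_less_mono) (simp add: power2_eq_square)
  thus ?thesis by (simp add: rho_eq)
qed

text \<open>rho is fixed by \<tau> -> -1/\<tau> - 1, and the weight-4 factor rho^4 = rho differs
  from 1. At i, weight 6 gives the factor i^6 = -1.\<close>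

lemma E4_rho: "E4 rho = 0"
proof -
  have "E4 (- 1 / rho) = rho ^ 4 * E4 rho" using Im_rho by (intro E4_minus_inverse) simp
  moreover have "E4 (- 1 / rho) = E4 rho" using E4_periodic[of rho 1] by (simp only: minus_inverse_rho of_int_1)
  moreover have "rho ^ 4 = rho" using rho_poly by algebra
  ultimately have "(rho - 1) * E4 rho = 0" by (simp add: algebra_simps)
  thus ?thesis using rho_neq_1 by simp
qed

lemma E6_i: "E6 \<i> = 0"
  using E6_minus_inverse[of \<i>] by (simp add: eval_nat_numeral)

text \<open>The deviation from slope c is too small to compensate |c| |q - p|, so f has at most one
  zero in the disc; \<open>qpar\<close> identifies exactly the integer translates.\<close>

lemma near_linear_zero_iff:
  assumes f: "\<And>p q. norm p \<le> 1 / 190 \<Longrightarrow> norm q \<le> 1 / 190 \<Longrightarrow> norm (f q - f p - c * (q - p)) \<le> r * norm (q - p)"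
    and r: "r < norm c" and a: "f (qpar a) = 0" "Im a > 17 / 20" and \<tau>: "Im \<tau> > 17 / 20"
  shows "f (qpar \<tau>) = 0 \<longleftrightarrow> (\<exists>n::int. \<tau> = a + of_int n)"
proof
  assume 0: "f (qpar \<tau>) = 0"
  have "norm (f (qpar \<tau>) - f (qpar a) - c * (qpar \<tau> - qpar a)) \<le> r * norm (qpar \<tau> - qpar a)"
    using norm_qpar_less[OF a(2)] norm_qpar_less[OF \<tau>] by (intro f) auto
  hence "norm c * norm (qpar \<tau> - qpar a) \<le> r * norm (qpar \<tau> - qpar a)" by (simp add: 0 a norm_mult)
  hence "(norm c - r) * norm (qpar \<tau> - qpar a) \<le> 0" by (simp add: algebra_simps)
  hence "norm (qpar \<tau> - qpar a) \<le> 0" using r by (simp add: mult_le_0_iff)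
  hence "qpar \<tau> = qpar a" by simp
  thus "\<exists>n::int. \<tau> = a + of_int n" by (simp add: qpar_eq_iff)
qed (use a in \<open>auto simp: qpar_add\<close>)

text \<open>Difference quotients stay within r of c, hence so does the derivative, which therefore
  cannot be 0. This makes the zero simple.\<close>

lemma near_linear_deriv_nonzero:
  fixes f :: "complex \<Rightarrow> complex"
  assumes f: "\<And>p q. norm p \<le> 1 / 190 \<Longrightarrow> norm q \<le> 1 / 190 \<Longrightarrow> norm (f q - f p - c * (q - p)) \<le> r * norm (q - p)"
    and r: "r < norm c" and a: "Im a > 17 / 20"
    and D: "(f has_field_derivative L) (at (qpar a))"
  shows "deriv (\<lambda>\<tau>. f (qpar \<tau>)) a \<noteq> 0"
proof -
  define p where "p = qpar a"
  have p: "norm p < 1 / 190" unfolding p_def by (rule norm_qpar_less[OF a])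
  have lim: "((\<lambda>q. norm ((f q - f p) / (q - p) - c)) \<longlongrightarrow> norm (L - c)) (at p)"
    using D by (intro tendsto_intros) (simp add: has_field_derivative_iff p_def)
  have "\<forall>\<^sub>F q in at p. q \<in> ball 0 (1 / 190)"
    using p by (intro eventually_at_in_open') auto
  moreover have "\<forall>\<^sub>F q in at p. q \<noteq> p" by (simp add: eventually_at_filter)
  ultimately have "\<forall>\<^sub>F q in at p. norm ((f q - f p) / (q - p) - c) \<le> r"
  proof eventually_elim
    case (elim q)
    hence "norm (f q - f p - c * (q - p)) / norm (q - p) \<le> r"
      using f[of p q] p by (simp add: divide_le_eq)
    moreover have "(f q - f p) / (q - p) - c = (f q - f p - c * (q - p)) / (q - p)"
      using elim by (simp add: divide_simps)
    ultimately show ?case by (simp add: norm_divide)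
  qed
  hence "norm (L - c) \<le> r" by (intro tendsto_upperbound[OF lim]) auto
  hence L: "L \<noteq> 0" using r by auto
  have "((\<lambda>\<tau>. f (qpar \<tau>)) has_field_derivative L * (2 * of_real pi * \<i> * qpar a)) (at a)"
    by (rule DERIV_chain2[OF D qpar_has_field_derivative])
  thus ?thesis using L by (simp add: DERIV_imp_deriv)
qed

lemma E4_zero_iff: "Im \<tau> > 17 / 20 \<Longrightarrow> E4 \<tau> = 0 \<longleftrightarrow> (\<exists>n::int. \<tau> = rho + of_int n)"
  unfolding E4_eq_E4q using E4_rho Im_rho
  by (intro near_linear_zero_iff[where c = 240 and r = 100] E4q_near_linear) (auto simp: E4_eq_E4q)

lemma E6_zero_iff: "Im \<tau> > 17 / 20 \<Longrightarrow> E6 \<tau> = 0 \<longleftrightarrow> (\<exists>n::int. \<tau> = \<i> + of_int n)"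
  unfolding E6_eq_E6q using E6_i
  by (intro near_linear_zero_iff[where c = "-504" and r = 450] E6q_near_linear) (auto simp: E6_eq_E6q)

lemma deriv_E4_rho: "deriv E4 rho \<noteq> 0"
proof -
  have "norm (qpar rho) < 1" using Im_rho by (intro norm_qpar_less_1) simp
  note D = sigma1_series_has_field_derivative[OF this qpar_nonzero]
  have "\<exists>L. (E4q has_field_derivative L) (at (qpar rho))"
    unfolding E4q_def[abs_def] by (rule exI) (rule derivative_eq_intros D refl)+
  thus ?thesis unfolding E4_eq_E4q[abs_def] using Im_rho
    by (elim exE, intro near_linear_deriv_nonzero[where c = 240 and r = 100] E4q_near_linear) auto
qed

lemma deriv_E6_i: "deriv E6 \<i> \<noteq> 0"
proof -
  have "norm (qpar \<i>) < 1" by (intro norm_qpar_less_1) simp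
  note D = sigma1_series_has_field_derivative[OF this qpar_nonzero]
  have "\<exists>L. (E6q has_field_derivative L) (at (qpar \<i>))"
    unfolding E6q_def[abs_def] by (rule exI) (rule derivative_eq_intros D refl)+
  thus ?thesis unfolding E6_eq_E6q[abs_def]
    by (elim exE, intro near_linear_deriv_nonzero[where c = "-504" and r = 450] E6q_near_linear) auto
qed

section \<open>Limits at the cusp and forms of weight zero\<close>

text \<open>Convergence along this filter is uniform in Re \<tau>, which yields bounds on whole half
  planes Im \<tau> \<ge> Y.\<close>

abbreviation at_i_infinity :: "complex filter" where
  "at_i_infinity \<equiv> filtercomap Im at_top"

lemma qpar_tendsto_0: "(qpar \<longlongrightarrow> 0) at_i_infinity"
proof (rule tendsto_norm_zero_cancel)
  have "filterlim (\<lambda>\<tau>. - 2 * pi * Im \<tau>) at_bot at_i_infinity"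
    by (rule filterlim_tendsto_neg_mult_at_bot[OF tendsto_const _ filterlim_filtercomap]) simp
  thus "((\<lambda>\<tau>. norm (qpar \<tau>)) \<longlongrightarrow> 0) at_i_infinity"
    unfolding norm_qpar by (rule filterlim_compose[OF exp_at_bot])
qed

lemma eventually_Im_gt: "\<forall>\<^sub>F \<tau> in at_i_infinity. Im \<tau> > c"
  using filterlim_filtercomap[of Im at_top] by (simp add: filterlim_at_top_dense)

lemma Dsig_tendsto_0:
  assumes "k \<le> 2"
  shows "(Dsig k \<longlongrightarrow> 0) at_i_infinity"
proof (rule Lim_null_comparison)
  show "((\<lambda>\<tau>. 59 / 50 * norm (qpar \<tau>)) \<longlongrightarrow> 0) at_i_infinity"
    using tendsto_mult[OF tendsto_const tendsto_norm_zero[OF qpar_tendsto_0], of "59 / 50"] by simp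
  show "\<forall>\<^sub>F \<tau> in at_i_infinity. norm (Dsig k \<tau>) \<le> 59 / 50 * norm (qpar \<tau>)"
    using eventually_Im_gt[of "17 / 20"] unfolding Dsig_def
    by eventually_elim (intro norm_sigma1_series_le[OF less_imp_le[OF norm_qpar_less] assms])
qed

lemma E2_tendsto_1: "(E2 \<longlongrightarrow> 1) at_i_infinity"
  unfolding E2_eq_Dsig[abs_def]
  using tendsto_diff[OF tendsto_const tendsto_mult[OF tendsto_const Dsig_tendsto_0[of 0]], of 1 24] by simp

lemma E4_tendsto_1: "(E4 \<longlongrightarrow> 1) at_i_infinity"
  unfolding E4_def[abs_def]
  using tendsto_add[OF tendsto_power[OF E2_tendsto_1, of 2] tendsto_mult[OF tendsto_const Dsig_tendsto_0[of 1], of 288]]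
  by simp

lemma E6_tendsto_1: "(E6 \<longlongrightarrow> 1) at_i_infinity"
proof -
  have "(E6 \<longlongrightarrow> 1 ^ 3 + 432 * 1 * 0 - 864 * 0) at_i_infinity"
    unfolding E6_def[abs_def] by (intro tendsto_intros E2_tendsto_1 Dsig_tendsto_0) auto
  thus ?thesis by simp
qed

lemma ex_int_shift: "\<exists>n::int. \<bar>Re (\<tau> + of_int n)\<bar> \<le> 1 / 2"
proof
  show "\<bar>Re (\<tau> + of_int (- round (Re \<tau>)))\<bar> \<le> 1 / 2"
    using of_int_round_abs_le[of "Re \<tau>"] by (simp add: abs_minus_commute)
qed

text \<open>
  Every point of the line \<open>Im \<tau> = 43/50\<close> is moved strictly upwards by a translation followed by
  \<open>\<tau> \<mapsto> -1/\<tau>\<close> (as \<open>43/50 < sqrt 3 / 2\<close>), so the maximum of \<open>\<bar>Q - 1\<bar>\<close> is attained in the interior.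
\<close>

lemma level_one_weight_zero_eq_1:
  fixes Q :: "complex \<Rightarrow> complex"
  assumes hol: "Q holomorphic_on {\<tau>. Im \<tau> > 17 / 20}"
    and per: "\<And>\<tau> n. Im \<tau> > 17 / 20 \<Longrightarrow> Q (\<tau> + of_int n) = Q \<tau>"
    and inv: "\<And>\<tau>. Im \<tau> > 17 / 20 \<Longrightarrow> Im (- 1 / \<tau>) > 17 / 20 \<Longrightarrow> Q (- 1 / \<tau>) = Q \<tau>"
    and lim: "(Q \<longlongrightarrow> 1) at_i_infinity"
    and \<tau>: "Im \<tau> > 17 / 20"
  shows "Q \<tau> = 1"
proof (rule ccontr)
  assume neq: "Q \<tau> \<noteq> 1"
  define H where "H = {\<tau>. Im \<tau> > 17 / 20}"
  define h where "h = (\<lambda>\<tau>. Q \<tau> - 1)"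
  have h_hol: "h holomorphic_on H" unfolding h_def H_def by (intro holomorphic_intros hol)
  have oH: "open H" unfolding H_def by (rule open_halfspace_Im_gt)
  have cH: "connected H" unfolding H_def by (intro convex_connected convex_halfspace_Im_gt)
  have hlim: "(h \<longlongrightarrow> 0) at_i_infinity" using tendsto_diff[OF lim tendsto_const[of 1]] by (simp add: h_def)
  \<comment> \<open>The maximum is sought over Im w \<ge> 43/50; the identity theorem transfers
    non-vanishing to that region.\<close>
  have "\<exists>\<tau>1. Im \<tau>1 \<ge> 43 / 50 \<and> h \<tau>1 \<noteq> 0"
  proof (rule ccontr)
    assume "\<not> ?thesis"
    hence z: "h w = 0" if "Im w \<ge> 43 / 50" for w using that by blast
    have "h \<tau> = 0"
    proof (rule analytic_continuation_open[of "{w. Im w > 43 / 50}" H h "\<lambda>_. 0"])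
      show "{w. Im w > 43 / 50} \<noteq> {}" by (auto intro!: exI[of _ \<i>])
      show "open {w. Im w > 43 / 50}" by (rule open_halfspace_Im_gt)
    qed (use z \<tau> in \<open>auto simp: oH cH h_hol\<close>, auto simp: H_def)
    thus False using neq by (simp add: h_def)
  qed
  then obtain \<tau>1 where \<tau>1: "Im \<tau>1 \<ge> 43 / 50" "h \<tau>1 \<noteq> 0" by blast
  define e where "e = norm (h \<tau>1)"
  have "\<forall>\<^sub>F w in at_i_infinity. norm (h w) < e"
    using tendstoD[OF hlim, of e] \<tau>1 by (simp add: e_def)
  then obtain Y where Y: "norm (h w) < e" if "Im w \<ge> Y" for w
    unfolding eventually_filtercomap eventually_at_top_linorder by blast
  have hper: "h (w + of_int n) = h w" if "Im w > 17 / 20" for w n using per[OF that] by (simp add: h_def)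
  \<comment> \<open>One period, cut off at a height above which |h| < e. By periodicity the maximum
    over \<open>K\<close> is a maximum over all of Im w \<ge> 43/50.\<close>
  define K where "K = {w. \<bar>Re w\<bar> \<le> 1 / 2 \<and> 43 / 50 \<le> Im w \<and> Im w \<le> max Y (Im \<tau>1)}"
  have K: "compact K"
  proof -
    have "K = cbox (Complex (- 1 / 2) (43 / 50)) (Complex (1 / 2) (max Y (Im \<tau>1)))"
      by (auto simp: K_def in_cbox_complex_iff abs_le_iff)
    thus ?thesis by simp
  qed
  obtain n1 :: int where n1: "\<bar>Re (\<tau>1 + of_int n1)\<bar> \<le> 1 / 2" using ex_int_shift by blast
  have inK: "\<tau>1 + of_int n1 \<in> K" using n1 \<tau>1 by (auto simp: K_def)
  have "continuous_on K (\<lambda>w. norm (h w))"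
    by (intro continuous_on_norm holomorphic_on_imp_continuous_on holomorphic_on_subset[OF h_hol])
       (auto simp: K_def H_def)
  from continuous_attains_sup[OF K _ this] inK
  obtain w0 where w0: "w0 \<in> K" "\<And>w. w \<in> K \<Longrightarrow> norm (h w) \<le> norm (h w0)" by blast
  have e0: "e \<le> norm (h w0)" using w0(2)[OF inK] hper[of \<tau>1 n1] \<tau>1 by (simp add: e_def)
  have max: "norm (h w) \<le> norm (h w0)" if "Im w \<ge> 43 / 50" for w
  proof (cases "Im w \<le> max Y (Im \<tau>1)")
    case True
    obtain n :: int where n: "\<bar>Re (w + of_int n)\<bar> \<le> 1 / 2" using ex_int_shift by blast
    hence "w + of_int n \<in> K" using True that by (auto simp: K_def)
    from w0(2)[OF this] show ?thesis using hper[of w n] that by simp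
  next
    case False
    hence "norm (h w) < e" by (intro Y) auto
    with e0 show ?thesis by simp
  qed
  have "\<exists>w1. Im w1 > 43 / 50 \<and> h w1 = h w0"
  proof (cases "Im w0 > 43 / 50")
    case False
    with w0 have w0': "Im w0 = 43 / 50" "\<bar>Re w0\<bar> \<le> 1 / 2" by (auto simp: K_def)
    have "Re w0 ^ 2 \<le> (1 / 2) ^ 2" using w0'(2) by (subst abs_le_square_iff[symmetric]) auto
    hence n1: "norm w0 ^ 2 < 1" unfolding cmod_power2 w0'(1) by (simp add: power2_eq_square)
    have "norm w0 ^ 2 > 0" using w0' by auto
    hence I: "Im (- 1 / w0) > 43 / 50" unfolding Im_minus_inverse w0'(1) using n1 by (simp add: field_simps)
    hence "h (- 1 / w0) = h w0" unfolding h_def using w0' by (subst inv) auto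
    with I show ?thesis by blast
  qed auto
  then obtain w1 where w1: "Im w1 > 43 / 50" "h w1 = h w0" by blast
  have "h constant_on H"
  proof (rule maximum_modulus_principle[OF h_hol oH cH])
    show "open {w. Im w > 43 / 50}" by (rule open_halfspace_Im_gt)
    show "w1 \<in> {w. Im w > 43 / 50}" using w1 by simp
  qed (use max w1 in \<open>auto simp: H_def\<close>)
  then obtain c where c: "\<And>w. w \<in> H \<Longrightarrow> h w = c" by (auto simp: constant_on_def)
  \<comment> \<open>A constant h takes its value also at heights above \<open>Y\<close>, where its
    norm is less than e.\<close>
  have "norm (h \<tau>1) < e"
    using Y[of "\<i> * of_real (max Y 1)"] c[of "\<i> * of_real (max Y 1)"] c[of \<tau>1] \<tau>1 by (auto simp: H_def)
  thus False by (simp add: e_def)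
qed

section \<open>Comparison of a form with a power of E4 or E6\<close>

locale level_one_form =
  fixes E :: "complex \<Rightarrow> complex" and a :: complex and w :: nat
  assumes holomorphic: "E holomorphic_on UHP"
    and periodic: "E (\<tau> + of_int n) = E \<tau>"
    and minus_inverse: "Im \<tau> > 0 \<Longrightarrow> E (- 1 / \<tau>) = \<tau> ^ w * E \<tau>"
    and tendsto_1: "(E \<longlongrightarrow> 1) at_i_infinity"
    and zero_iff: "Im \<tau> > 17 / 20 \<Longrightarrow> E \<tau> = 0 \<longleftrightarrow> (\<exists>n::int. \<tau> = a + of_int n)"
    and simple_zero: "deriv E a \<noteq> 0"
    and Im_zero: "Im a > 17 / 20"
begin

text \<open>P / E^m has weight 0, and its singularities in Im \<tau> > 17/20 are removable: E has
  simple zeros at the translates of a, where P vanishes to order m. The claim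
  \<open>h a \<noteq> 0\<close> says that this order is exact, which rules out further vanishing
  factors of P at a itself.\<close>

lemma eq_power:
  fixes P h :: "complex \<Rightarrow> complex"
  assumes m: "m > 0"
    and P_periodic: "\<And>\<tau> n. P (\<tau> + of_int n) = P \<tau>"
    and P_minus_inverse: "\<And>\<tau>. Im \<tau> > 0 \<Longrightarrow> P (- 1 / \<tau>) = \<tau> ^ (w * m) * P \<tau>"
    and P_tendsto: "(P \<longlongrightarrow> 1) at_i_infinity"
    and P_factor: "\<And>\<tau>. Im \<tau> > 0 \<Longrightarrow> P \<tau> = (\<tau> - a) ^ m * h \<tau>"
    and h: "h holomorphic_on UHP"
  shows "Im \<tau> > 17 / 20 \<Longrightarrow> P \<tau> = E \<tau> ^ m" and "h a \<noteq> 0"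
proof -
  define H where "H = {\<tau>. Im \<tau> > 17 / 20}"
  have oH: "open H" unfolding H_def by (rule open_halfspace_Im_gt)
  have HU: "H \<subseteq> UHP" and aH: "a \<in> H" using Im_zero by (auto simp: H_def)
  have Ea: "E a = 0" using zero_iff[OF Im_zero] by (metis add.right_neutral of_int_0)
  define u where "u = (\<lambda>z. if z = a then deriv E a else (E z - E a) / (z - a))"
  have u: "u holomorphic_on UHP" unfolding u_def by (rule pole_lemma_open[OF holomorphic open_UHP])
  have Eu: "E z = (z - a) * u z" for z by (simp add: u_def Ea)
  have ua: "u a \<noteq> 0" by (simp add: u_def simple_zero)
  have P: "P holomorphic_on UHP"
    by (rule holomorphic_transform[of "\<lambda>\<tau>. (\<tau> - a) ^ m * h \<tau>"]) (auto intro!: holomorphic_intros h simp: P_factor)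
  define R where "R = (\<lambda>z. h z / u z ^ m)"
  \<comment> \<open>All zeros of E in \<open>H\<close> are translates of a, so by periodicity one
    value fills every gap there.\<close>
  define Q where "Q = (\<lambda>z. if E z = 0 then R a else P z / E z ^ m)"
  have QR: "Q z = R z" if "z \<in> H" "u z \<noteq> 0" for z
  proof (cases "z = a")
    case True
    thus ?thesis by (simp add: Q_def Ea)
  next
    case False
    hence "E z \<noteq> 0" using that by (simp add: Eu)
    moreover have "P z = (z - a) ^ m * h z" using that HU by (intro P_factor) auto
    ultimately show ?thesis using that False by (simp add: Q_def R_def Eu power_mult_distrib)
  qed
  have Q_per: "Q (z + of_int n) = Q z" for z n by (simp add: Q_def periodic P_periodic)
  have local: "Q field_differentiable at z"
    if "open S" "z \<in> S" "g holomorphic_on S" "\<And>x. x \<in> S \<Longrightarrow> Q x = g x" for S z g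
  proof -
    have "Q holomorphic_on S" using that by (intro holomorphic_transform[OF that(3)]) auto
    thus ?thesis using that by (auto intro: holomorphic_on_imp_differentiable_at)
  qed
  have op: "open {z \<in> H. f z \<noteq> 0}" if "f holomorphic_on UHP" for f :: "complex \<Rightarrow> complex"
  proof -
    have "continuous_on H f"
      by (rule holomorphic_on_imp_continuous_on[OF holomorphic_on_subset[OF that HU]])
    hence "open (H \<inter> f -` (- {0}))" by (intro continuous_open_preimage oH) auto
    moreover have "H \<inter> f -` (- {0}) = {z \<in> H. f z \<noteq> 0}" by auto
    ultimately show ?thesis by simp
  qed
  have "Q holomorphic_on H"
    unfolding holomorphic_on_def
  proof (rule ballI, rule field_differentiable_at_within)
    fix z assume z: "z \<in> H"
    show "Q field_differentiable at z"
    proof (cases "E z = 0")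
      case False
      define W where "W = {z \<in> H. E z \<noteq> 0}"
      have W: "open W" unfolding W_def by (rule op[OF holomorphic])
      have "P holomorphic_on W" by (rule holomorphic_on_subset[OF P]) (use HU W_def in blast)
      moreover have "E holomorphic_on W" by (rule holomorphic_on_subset[OF holomorphic]) (use HU W_def in blast)
      ultimately have PE: "(\<lambda>z. P z / E z ^ m) holomorphic_on W"
        by (intro holomorphic_on_divide holomorphic_on_power) (auto simp: W_def)
      have QW: "Q x = P x / E x ^ m" if "x \<in> W" for x using that by (simp add: W_def Q_def)
      have "z \<in> W" using z False by (simp add: W_def)
      from local[OF W this PE QW] show ?thesis .
    next
      case True
      then obtain n :: int where n: "z = a + of_int n" using zero_iff z by (auto simp: H_def)
      define V where "V = {z \<in> H. u z \<noteq> 0}"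
      have V: "open V" unfolding V_def by (rule op[OF u])
      have RV: "R holomorphic_on V"
      proof -
        have "h holomorphic_on V" "u holomorphic_on V"
          by (rule holomorphic_on_subset[OF h] holomorphic_on_subset[OF u], use HU V_def in blast)+
        thus ?thesis unfolding R_def by (intro holomorphic_on_divide holomorphic_on_power) (auto simp: V_def)
      qed
      \<comment> \<open>Near a + n the function Q is the local quotient R at a, shifted by
        n.\<close>
      define W where "W = (\<lambda>z. z - of_int n) -` V"
      have W: "open W" unfolding W_def by (intro open_vimage V continuous_intros)
      have "R \<circ> (\<lambda>z. z - of_int n) holomorphic_on W"
        by (rule holomorphic_on_compose_gen[OF _ RV]) (auto simp: W_def intro!: holomorphic_intros)
      hence RW: "(\<lambda>z. R (z - of_int n)) holomorphic_on W" by (simp add: o_def)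
      have zW: "z \<in> W" using n aH ua by (simp add: V_def W_def)
      have QW: "Q x = R (x - of_int n)" if "x \<in> W" for x
      proof -
        have "Q (x - of_int n) = R (x - of_int n)" using that by (intro QR) (auto simp: V_def W_def)
        thus ?thesis using Q_per[of "x - of_int n" n] by simp
      qed
      from local[OF W zW RW QW] show ?thesis .
    qed
  qed
  moreover have "Q (- 1 / z) = Q z" if z: "Im z > 17 / 20" for z
  proof -
    have "Im z > 0" using z by simp
    moreover have "z \<noteq> 0" using z by auto
    ultimately show ?thesis
      by (simp only: Q_def minus_inverse P_minus_inverse) (simp add: power_mult power_mult_distrib)
  qed
  moreover have "(Q \<longlongrightarrow> 1) at_i_infinity"
  proof -
    have "\<forall>\<^sub>F z in at_i_infinity. E z \<noteq> 0" using tendsto_imp_eventually_ne[OF tendsto_1] by simp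
    hence "\<forall>\<^sub>F z in at_i_infinity. P z / E z ^ m = Q z" by eventually_elim (simp add: Q_def)
    moreover have "((\<lambda>z. P z / E z ^ m) \<longlongrightarrow> 1 / 1 ^ m) at_i_infinity"
      by (intro tendsto_intros tendsto_1 P_tendsto) auto
    ultimately show ?thesis by (simp add: tendsto_cong)
  qed
  ultimately have Q1: "Q z = 1" if "z \<in> H" for z
    using that Q_per unfolding H_def by (intro level_one_weight_zero_eq_1) auto
  show "P \<tau> = E \<tau> ^ m" if \<tau>: "Im \<tau> > 17 / 20"
  proof (cases "E \<tau> = 0")
    case False
    thus ?thesis using Q1[of \<tau>] \<tau> by (simp add: Q_def H_def)
  next
    case True
    then obtain n :: int where n: "\<tau> = a + of_int n" using zero_iff[OF \<tau>] by auto
    have "P \<tau> = P a" by (simp add: n P_periodic)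
    also have "\<dots> = 0" using P_factor[of a] Im_zero m by simp
    finally show ?thesis using True m by simp
  qed
  have "Q a = R a" by (rule QR[OF aH ua])
  thus "h a \<noteq> 0" using Q1[OF aH] by (auto simp: R_def)
qed

end

interpretation E4: level_one_form E4 rho 4
proof
  show "E4 holomorphic_on UHP" by (rule E4_holomorphic)
  show "E4 (\<tau> + of_int n) = E4 \<tau>" for \<tau> n by (rule E4_periodic)
  show "E4 (- 1 / \<tau>) = \<tau> ^ 4 * E4 \<tau>" if "Im \<tau> > 0" for \<tau> by (rule E4_minus_inverse[OF that])
  show "(E4 \<longlongrightarrow> 1) at_i_infinity" by (rule E4_tendsto_1)
  show "E4 \<tau> = 0 \<longleftrightarrow> (\<exists>n::int. \<tau> = rho + of_int n)" if "Im \<tau> > 17 / 20" for \<tau>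
    by (rule E4_zero_iff[OF that])
  show "deriv E4 rho \<noteq> 0" by (rule deriv_E4_rho)
qed (use Im_rho in simp)

interpretation E6: level_one_form E6 \<i> 6
proof
  show "E6 holomorphic_on UHP" by (rule E6_holomorphic)
  show "E6 (\<tau> + of_int n) = E6 \<tau>" for \<tau> n by (rule E6_periodic)
  show "E6 (- 1 / \<tau>) = \<tau> ^ 6 * E6 \<tau>" if "Im \<tau> > 0" for \<tau> by (rule E6_minus_inverse[OF that])
  show "(E6 \<longlongrightarrow> 1) at_i_infinity" by (rule E6_tendsto_1)
  show "E6 \<tau> = 0 \<longleftrightarrow> (\<exists>n::int. \<tau> = \<i> + of_int n)" if "Im \<tau> > 17 / 20" for \<tau>
    by (rule E6_zero_iff[OF that])
  show "deriv E6 \<i> \<noteq> 0" by (rule deriv_E6_i)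
qed (simp)

text \<open>
  The non-holomorphic correction makes \<open>E2\<close> exactly modular of weight 2, and it cancels in \<open>Etilde N\<close>.
\<close>

definition E2_star :: "complex \<Rightarrow> complex" where
  "E2_star \<tau> = E2 \<tau> - 3 / (of_real pi * of_real (Im \<tau>))"

lemma E2_star_periodic: "E2_star (\<tau> + of_int n) = E2_star \<tau>"
  by (simp add: E2_star_def E2_periodic)

text \<open>As |\<tau>|^2 = \<tau> (\<tau> - 2iy), the correction at -1/\<tau> splits into \<tau>^2
  times the correction at \<tau> and a term that cancels -6 i \<tau> / pi.\<close>

lemma E2_star_minus_inverse:
  assumes \<tau>: "Im \<tau> > 0"
  shows "E2_star (- 1 / \<tau>) = \<tau> ^ 2 * E2_star \<tau>"
proof -
  define y p where "y = complex_of_real (Im \<tau>)" and "p = complex_of_real pi"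
  have y: "y \<noteq> 0" and p: "p \<noteq> 0" and t: "\<tau> \<noteq> 0" using \<tau> by (auto simp: y_def p_def)
  have cnj: "cnj \<tau> = \<tau> - 2 * \<i> * y" by (simp add: complex_eq_iff y_def)
  have "of_real (norm \<tau> ^ 2) = \<tau> * cnj \<tau>" by (rule complex_norm_square)
  hence nrm: "of_real (norm \<tau> ^ 2) = \<tau> * (\<tau> - 2 * \<i> * y)" by (simp only: cnj)
  have t2: "\<tau> * (\<tau> - 2 * \<i> * y) \<noteq> 0" using t by (simp flip: nrm)
  have "of_real (Im (- 1 / \<tau>)) = y / (\<tau> * (\<tau> - 2 * \<i> * y))"
    unfolding Im_minus_inverse of_real_divide nrm y_def ..
  hence "E2_star (- 1 / \<tau>) = \<tau> ^ 2 * E2 \<tau> - 6 * \<i> * \<tau> / p - 3 * (\<tau> * (\<tau> - 2 * \<i> * y)) / (p * y)"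
    using E2_minus_inverse[OF \<tau>] t2 by (simp add: E2_star_def p_def)
  also have "\<dots> = \<tau> ^ 2 * (E2 \<tau> - 3 / (p * y))"
    using y p by (simp add: field_simps power2_eq_square)
  finally show ?thesis by (simp add: E2_star_def p_def y_def)
qed

text \<open>Euclid's algorithm on the bottom row: with d = qc + r, the matrix is the product of (b -
  aq, -a; r, -c) with S T^q, and |r| < |c|. The base case c = 0 is a translation up to sign.\<close>

lemma E2_star_SL2:
  fixes a b c d :: int
  assumes "a * d - b * c = 1" "Im \<tau> > 0"
  shows "E2_star ((of_int a * \<tau> + of_int b) / (of_int c * \<tau> + of_int d)) = (of_int c * \<tau> + of_int d) ^ 2 * E2_star \<tau>"
  using assms
proof (induction "nat \<bar>c\<bar>" arbitrary: a b c d \<tau> rule: less_induct)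
  case less
  show ?case
  proof (cases "c = 0")
    case True
    hence "a * d = 1" using less.prems by simp
    hence "a = 1 \<and> d = 1 \<or> a = - 1 \<and> d = - 1" using zmult_eq_1_iff by auto
    thus ?thesis
    proof
      assume "a = - 1 \<and> d = - 1"
      thus ?thesis using E2_star_periodic[of \<tau> "- b"] True by simp
    qed (use E2_star_periodic[of \<tau> b] True in simp)
  next
    case False
    define q r where "q = d div c" and "r = d mod c"
    have d: "d = q * c + r" by (simp add: q_def r_def)
    have rc: "nat \<bar>r\<bar> < nat \<bar>c\<bar>" using False by (simp add: r_def abs_mod_less)
    define \<tau>1 \<tau>2 where "\<tau>1 = \<tau> + of_int q" and "\<tau>2 = - 1 / \<tau>1"
    have I1: "Im \<tau>1 > 0" using less.prems by (simp add: \<tau>1_def)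
    have I2: "Im \<tau>2 > 0" unfolding \<tau>2_def by (rule Im_minus_inverse_pos[OF I1])
    have t1: "\<tau>1 \<noteq> 0" using I1 by auto
    define b1 where "b1 = b - a * q"
    have det: "b1 * (- c) - (- a) * r = 1" using less.prems(1) by (simp add: b1_def d algebra_simps)
    define X Y where "X = of_int a * \<tau> + of_int b" and "Y = of_int c * \<tau> + of_int d"
    have den: "of_int r * \<tau>2 + of_int (- c) = - Y / \<tau>1"
      using t1 by (simp add: \<tau>2_def Y_def d field_simps) (simp add: \<tau>1_def algebra_simps)
    have num: "of_int b1 * \<tau>2 + of_int (- a) = - X / \<tau>1"
      using t1 by (simp add: \<tau>2_def X_def b1_def field_simps) (simp add: \<tau>1_def algebra_simps)
    have IH: "E2_star ((of_int b1 * \<tau>2 + of_int (- a)) / (of_int r * \<tau>2 + of_int (- c)))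
         = (of_int r * \<tau>2 + of_int (- c)) ^ 2 * E2_star \<tau>2"
      by (rule less.hyps[OF rc det I2])
    have "E2_star \<tau>2 = \<tau>1 ^ 2 * E2_star \<tau>"
      unfolding \<tau>2_def using E2_star_minus_inverse[OF I1] E2_star_periodic[of \<tau> q] by (simp add: \<tau>1_def)
    hence "E2_star ((- X / \<tau>1) / (- Y / \<tau>1)) = (- Y / \<tau>1) ^ 2 * (\<tau>1 ^ 2 * E2_star \<tau>)"
      using IH unfolding den num by simp
    moreover have "(- X / \<tau>1) / (- Y / \<tau>1) = X / Y" using t1 by simp
    moreover have "(- Y / \<tau>1) ^ 2 * (\<tau>1 ^ 2 * E2_star \<tau>) = Y ^ 2 * E2_star \<tau>"
      using t1 by (simp add: power_divide)
    ultimately show ?thesis unfolding X_def Y_def by simp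
  qed
qed

section \<open>Conjugates of Etilde\<close>

lemma Etilde_eq_E2_star:
  assumes "N > 0"
  shows "Etilde N \<tau> = (of_nat N * E2_star (of_nat N * \<tau>) - E2_star \<tau>) / (of_nat N - 1)"
  using assms by (simp add: Etilde_def E2_star_def field_simps)

lemma Etilde_periodic: "Etilde N (\<tau> + of_int n) = Etilde N \<tau>"
  using E2_periodic[of "of_nat N * \<tau>" "int N * n"] by (simp add: Etilde_def E2_periodic distrib_left)

text \<open>The inversion exchanges the two terms of \<open>Etilde\<close>, whence the sign. With w
  = \<tau> + k it converts values on ST^k(\<open>F_Gamma\<close>) into values of a coset
  function.\<close>

lemma Etilde_minus_inverse:
  assumes N: "N > 0" and w: "Im w > 0"
  shows "Etilde N (- 1 / w) = - (w ^ 2 / of_nat N) * Etilde N (w / of_nat N)"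
proof -
  have w0: "w \<noteq> 0" using w by auto
  have "Im (w / of_nat N) > 0" using w N by (simp add: Im_divide_of_nat)
  hence "E2_star (of_nat N * (- 1 / w)) = (w / of_nat N) ^ 2 * E2_star (w / of_nat N)"
    using E2_star_minus_inverse[of "w / of_nat N"] by simp
  moreover have "E2_star (- 1 / w) = w ^ 2 * E2_star w" by (rule E2_star_minus_inverse[OF w])
  ultimately show ?thesis
    using N unfolding Etilde_eq_E2_star[OF N]
    by (simp add: power_divide divide_simps) (simp add: algebra_simps power2_eq_square)
qed

text \<open>The weight-2 translate of \<open>Etilde N\<close> by ST^k up to a nonzero constant,
  scaled to tend to 1 at the cusp.\<close>

definition Etilde_coset :: "nat \<Rightarrow> nat \<Rightarrow> complex \<Rightarrow> complex" where
  "Etilde_coset N k \<tau> = Etilde N ((\<tau> + of_nat k) / of_nat N)"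

lemma Im_coset: "Im ((\<tau> + of_nat k) / of_nat N) = Im \<tau> / real N"
  by (simp add: Im_divide_of_nat)

text \<open>With k k' + 1 = N b, the matrix (k, -b; N, -k') has determinant 1 and sends (\<tau> +
  k')/N to (-1/\<tau> + k)/N.\<close>

lemma Etilde_coset_minus_inverse:
  assumes N: "N > 0" and \<tau>: "Im \<tau> > 0" and kk: "N dvd k * k' + 1"
  shows "Etilde_coset N k (- 1 / \<tau>) = \<tau> ^ 2 * Etilde_coset N k' \<tau>"
proof -
  obtain b where b: "k * k' + 1 = N * b" using kk by (elim dvdE)
  define z where "z = (\<tau> + of_nat k') / of_nat N"
  have t0: "\<tau> \<noteq> 0" using \<tau> by auto
  have Iz: "Im z > 0" unfolding z_def Im_coset using \<tau> N by simp
  have bi: "int k * int k' + 1 = int N * int b" using b by (metis of_nat_1 of_nat_add of_nat_mult)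
  have "E2_star ((of_int (int k) * z + of_int (- int b)) / (of_int (int N) * z + of_int (- int k')))
     = (of_int (int N) * z + of_int (- int k')) ^ 2 * E2_star z"
    by (rule E2_star_SL2[OF _ Iz]) (use bi in \<open>simp add: algebra_simps\<close>)
  moreover have Nz: "of_int (int N) * z + of_int (- int k') = \<tau>" using N by (simp add: z_def)
  moreover have "(of_int (int k) * z + of_int (- int b)) / \<tau> = (- 1 / \<tau> + of_nat k) / of_nat N"
  proof -
    have "of_nat k * of_nat k' + 1 = (of_nat N * of_nat b :: complex)"
      using b by (metis of_nat_1 of_nat_add of_nat_mult)
    thus ?thesis using N t0 by (simp add: z_def field_simps)
  qed
  ultimately have 1: "E2_star ((- 1 / \<tau> + of_nat k) / of_nat N) = \<tau> ^ 2 * E2_star z" by simp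
  have "E2_star (of_nat N * ((- 1 / \<tau> + of_nat k) / of_nat N)) = E2_star (- 1 / \<tau>)"
    using E2_star_periodic[of "- 1 / \<tau>" "int k"] N by simp
  also have "\<dots> = \<tau> ^ 2 * E2_star \<tau>" by (rule E2_star_minus_inverse[OF \<tau>])
  also have "E2_star \<tau> = E2_star (of_nat N * z)"
    using E2_star_periodic[of \<tau> "int k'"] N by (simp add: z_def)
  finally have 2: "E2_star (of_nat N * ((- 1 / \<tau> + of_nat k) / of_nat N)) = \<tau> ^ 2 * E2_star (of_nat N * z)" .
  show ?thesis unfolding Etilde_coset_def Etilde_eq_E2_star[OF N] 1 2 z_def[symmetric]
    by (simp add: algebra_simps)
qed

lemma Etilde_holomorphic: "N > 0 \<Longrightarrow> Etilde N holomorphic_on UHP"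
proof -
  assume N: "N > 0"
  have "E2 \<circ> (\<lambda>\<tau>. of_nat N * \<tau>) holomorphic_on UHP"
    by (rule holomorphic_on_compose_gen[OF _ E2_holomorphic]) (use N in \<open>auto intro!: holomorphic_intros\<close>)
  hence 1: "(\<lambda>\<tau>. E2 (of_nat N * \<tau>)) holomorphic_on UHP" by (simp add: o_def)
  show ?thesis unfolding Etilde_def[abs_def] divide_inverse
    by (intro holomorphic_on_mult holomorphic_on_diff holomorphic_on_const 1 E2_holomorphic)
qed

lemma Etilde_coset_holomorphic:
  assumes N: "N > 0"
  shows "Etilde_coset N k holomorphic_on UHP"
proof -
  have "Etilde N \<circ> (\<lambda>\<tau>. (\<tau> + of_nat k) / of_nat N) holomorphic_on UHP"
    by (rule holomorphic_on_compose_gen[OF _ Etilde_holomorphic[OF N]])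
       (use N in \<open>auto intro!: holomorphic_intros simp: Im_coset\<close>)
  thus ?thesis by (simp add: o_def Etilde_coset_def[abs_def])
qed

lemma filterlim_at_i_infinity_affine:
  assumes "c > 0"
  shows "filterlim (\<lambda>\<tau>. of_real c * \<tau> + of_real d) at_i_infinity at_i_infinity"
proof -
  have "filterlim (\<lambda>\<tau>. c * Im \<tau>) at_top at_i_infinity"
    by (rule filterlim_tendsto_pos_mult_at_top[OF tendsto_const assms filterlim_filtercomap])
  thus ?thesis by (simp add: filterlim_filtercomap_iff o_def)
qed

lemma Etilde_tendsto_1:
  assumes N: "N \<ge> 2"
  shows "(Etilde N \<longlongrightarrow> 1) at_i_infinity"
proof -
  have "filterlim (\<lambda>\<tau>. of_nat N * \<tau>) at_i_infinity at_i_infinity"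
    using filterlim_at_i_infinity_affine[of "real N" 0] N by simp
  hence 1: "((\<lambda>\<tau>. E2 (of_nat N * \<tau>)) \<longlongrightarrow> 1) at_i_infinity"
    by (rule filterlim_compose[OF E2_tendsto_1])
  have "of_nat N \<noteq> (1 :: complex)" using N by (simp only: of_nat_eq_1_iff)
  hence N1: "of_nat N - 1 \<noteq> (0 :: complex)" by simp
  have "(Etilde N \<longlongrightarrow> (of_nat N * 1 - 1) / (of_nat N - 1)) at_i_infinity"
    unfolding Etilde_def[abs_def] by (intro tendsto_intros 1 E2_tendsto_1 N1)
  thus ?thesis using N1 by simp
qed

lemma Etilde_coset_tendsto_1:
  assumes N: "N \<ge> 2"
  shows "(Etilde_coset N k \<longlongrightarrow> 1) at_i_infinity"
proof -
  have "filterlim (\<lambda>\<tau>. of_real (1 / real N) * \<tau> + of_real (real k / real N)) at_i_infinity at_i_infinity"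
    using N by (intro filterlim_at_i_infinity_affine) simp
  also have "(\<lambda>\<tau>. of_real (1 / real N) * \<tau> + of_real (real k / real N)) = (\<lambda>\<tau>. (\<tau> + of_nat k) / of_nat N :: complex)"
    by (simp add: add_divide_distrib)
  finally show ?thesis unfolding Etilde_coset_def[abs_def]
    by (rule filterlim_compose[OF Etilde_tendsto_1[OF N]])
qed

lemma Etilde_coset_0_minus_inverse:
  assumes N: "N > 0" and \<tau>: "Im \<tau> > 0"
  shows "Etilde_coset N 0 (- 1 / \<tau>) = - (of_nat N * \<tau> ^ 2) * Etilde N \<tau>"
proof -
  have "Im (of_nat N * \<tau>) > 0" using N \<tau> by simp
  from Etilde_minus_inverse[OF N this] show ?thesis
    using N by (simp add: Etilde_coset_def power_mult_distrib power2_eq_square field_simps)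
qed

lemma Etilde_coset_shift: "Etilde_coset N k (\<tau> + 1) = Etilde_coset N (Suc k) \<tau>"
  by (simp add: Etilde_coset_def add_ac)

lemma Etilde_coset_self:
  assumes "N > 0"
  shows "Etilde_coset N N \<tau> = Etilde_coset N 0 \<tau>"
  using Etilde_periodic[of N "\<tau> / of_nat N" 1] assms by (simp add: Etilde_coset_def add_divide_distrib)

section \<open>The product over the cosets and its zeros\<close>

definition Etilde_norm :: "nat \<Rightarrow> complex \<Rightarrow> complex" where
  "Etilde_norm N \<tau> = Etilde N \<tau> * (\<Prod>k<N. Etilde_coset N k \<tau>)"

lemma periodic_of_int:
  fixes f :: "complex \<Rightarrow> 'a"
  assumes f: "\<And>\<tau>. f (\<tau> + 1) = f \<tau>"
  shows "f (\<tau> + of_int n) = f \<tau>"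
proof -
  have nat: "f (\<tau> + of_nat m) = f \<tau>" for m \<tau>
  proof (induction m)
    case (Suc m)
    have "f (\<tau> + of_nat (Suc m)) = f (\<tau> + of_nat m + 1)" by (simp add: add_ac)
    thus ?case using f Suc by simp
  qed simp
  show ?thesis
  proof (cases n)
    case (nonneg m)
    thus ?thesis using nat by simp
  next
    case (neg m)
    hence "\<tau> + of_int n = \<tau> - of_nat (Suc m)" by simp
    thus ?thesis using nat[of "\<tau> - of_nat (Suc m)" "Suc m"] by (simp only: diff_add_cancel)
  qed
qed

text \<open>Translation by 1 permutes the coset factors cyclically.\<close>

lemma Etilde_norm_periodic:
  assumes N: "N > 0"
  shows "Etilde_norm N (\<tau> + of_int n) = Etilde_norm N \<tau>"
proof (rule periodic_of_int)
  fix \<tau>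
  obtain M where M: "N = Suc M" using N by (cases N) auto
  have "(\<Prod>k<N. Etilde_coset N k (\<tau> + 1)) = (\<Prod>k<N. Etilde_coset N (Suc k) \<tau>)"
    by (simp add: Etilde_coset_shift)
  also have "\<dots> = (\<Prod>k<M. Etilde_coset N (Suc k) \<tau>) * Etilde_coset N N \<tau>" by (simp add: M)
  also have "\<dots> = Etilde_coset N 0 \<tau> * (\<Prod>k<M. Etilde_coset N (Suc k) \<tau>)"
    by (simp add: Etilde_coset_self[OF N])
  also have "\<dots> = (\<Prod>k<N. Etilde_coset N k \<tau>)" unfolding M prod.lessThan_Suc_shift ..
  finally show "Etilde_norm N (\<tau> + 1) = Etilde_norm N \<tau>"
    using Etilde_periodic[of N \<tau> 1] by (simp add: Etilde_norm_def)
qed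

text \<open>\<open>\<sigma>\<close> is k -> -1/k mod N and permutes N - 1 factors of weight 2.
  \<open>Etilde N\<close> and the factor with index 0 are exchanged, with multipliers -\<tau>^2/N
  and -N \<tau>^2 of product \<tau>^4.\<close>

lemma Etilde_norm_minus_inverse:
  assumes N: "N > 0" and \<tau>: "Im \<tau> > 0"
    and \<sigma>: "bij_betw \<sigma> {1..<N} {1..<N}" "\<And>k. k \<in> {1..<N} \<Longrightarrow> N dvd k * \<sigma> k + 1"
  shows "Etilde_norm N (- 1 / \<tau>) = \<tau> ^ (2 * N + 2) * Etilde_norm N \<tau>"
proof -
  have split: "(\<Prod>k<N. f k) = f 0 * (\<Prod>k\<in>{1..<N}. f k)" for f :: "nat \<Rightarrow> complex"
    using prod.atLeast_Suc_lessThan[of 0 N f] N by (simp add: lessThan_atLeast0)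
  have "(\<Prod>k\<in>{1..<N}. Etilde_coset N k (- 1 / \<tau>)) = (\<Prod>k\<in>{1..<N}. \<tau> ^ 2 * Etilde_coset N (\<sigma> k) \<tau>)"
    by (intro prod.cong refl Etilde_coset_minus_inverse N \<tau> \<sigma>)
  also have "\<dots> = (\<tau> ^ 2) ^ (N - 1) * (\<Prod>k\<in>{1..<N}. Etilde_coset N (\<sigma> k) \<tau>)"
    by (simp add: prod.distrib)
  also have "(\<Prod>k\<in>{1..<N}. Etilde_coset N (\<sigma> k) \<tau>) = (\<Prod>k\<in>{1..<N}. Etilde_coset N k \<tau>)"
    by (rule prod.reindex_bij_betw[OF \<sigma>(1)])
  finally have 1: "(\<Prod>k\<in>{1..<N}. Etilde_coset N k (- 1 / \<tau>)) = (\<tau> ^ 2) ^ (N - 1) * (\<Prod>k\<in>{1..<N}. Etilde_coset N k \<tau>)" .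
  have 2: "Etilde N (- 1 / \<tau>) = - (\<tau> ^ 2 / of_nat N) * Etilde_coset N 0 \<tau>"
    using Etilde_minus_inverse[OF N \<tau>] by (simp add: Etilde_coset_def)
  have "(\<tau> ^ 2) ^ (N - 1) * \<tau> ^ 4 = \<tau> ^ (2 * N + 2)"
    using N by (simp flip: power_mult power_add add: algebra_simps)
  hence 3: "\<tau> ^ (2 * N + 2) = (\<tau> ^ 2) ^ (N - 1) * \<tau> ^ 4" ..
  show ?thesis unfolding Etilde_norm_def split 1 2 3 Etilde_coset_0_minus_inverse[OF N \<tau>]
    using N by (simp add: field_simps)
qed

lemma Etilde_norm_tendsto_1:
  assumes N: "N \<ge> 2"
  shows "(Etilde_norm N \<longlongrightarrow> 1) at_i_infinity"
proof -
  have "(Etilde_norm N \<longlongrightarrow> 1 * (\<Prod>k<N. 1)) at_i_infinity"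
    unfolding Etilde_norm_def[abs_def]
    by (intro tendsto_mult tendsto_prod Etilde_tendsto_1 Etilde_coset_tendsto_1 N)
  thus ?thesis by simp
qed

lemma F_Gamma_Im:
  assumes "\<tau> \<in> F_Gamma"
  shows "Im \<tau> > 17 / 20"
proof -
  have \<tau>: "Im \<tau> > 0" "- 1 / 2 \<le> Re \<tau>" "Re \<tau> < 1 / 2" "Re \<tau> ^ 2 + Im \<tau> ^ 2 \<ge> 1"
    using assms by (auto simp: F_Gamma_def)
  have "Re \<tau> ^ 2 \<le> (1 / 2) ^ 2" using \<tau> by (subst abs_le_square_iff[symmetric]) auto
  hence "Im \<tau> ^ 2 > (17 / 20) ^ 2" using \<tau> by (simp add: power2_eq_square)
  thus ?thesis using \<tau>(1) by (rule power2_less_imp_less[OF _ less_imp_le])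
qed

context level_one_form
begin

text \<open>\<open>J\<close> indexes the elliptic cosets and e is the forced order at a. The weight
  equation makes the norm equal to E^(e * card J), so the forced zeros are all there are.\<close>

lemma Etilde_zeros_level:
  assumes N: "N \<ge> 2" and a: "a \<in> F_Gamma"
    and \<sigma>: "bij_betw \<sigma> {1..<N} {1..<N}" "\<And>k. k \<in> {1..<N} \<Longrightarrow> N dvd k * \<sigma> k + 1"
    and J: "J \<subseteq> {..<N}" "J \<noteq> {}" "e > 0" "w * (e * card J) = 2 * N + 2"
    and ord: "\<And>k. k \<in> J \<Longrightarrow> \<exists>h. h holomorphic_on UHP \<and> (\<forall>\<tau>. Im \<tau> > 0 \<longrightarrow> Etilde_coset N k \<tau> = (\<tau> - a) ^ e * h \<tau>)"
  shows "{\<tau> \<in> F_level N. Etilde N \<tau> = 0} = (\<lambda>k. ST k a) ` J"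
proof -
  have N0: "N > 0" using N by simp
  have finJ: "finite J" using J(1) finite_subset by blast
  obtain H where H: "\<And>k. k \<in> J \<Longrightarrow> H k holomorphic_on UHP"
    and G: "\<And>k \<tau>. k \<in> J \<Longrightarrow> Im \<tau> > 0 \<Longrightarrow> Etilde_coset N k \<tau> = (\<tau> - a) ^ e * H k \<tau>"
    using bchoice[of J "\<lambda>k h. h holomorphic_on UHP \<and> (\<forall>\<tau>. Im \<tau> > 0 \<longrightarrow> Etilde_coset N k \<tau> = (\<tau> - a) ^ e * h \<tau>)"] ord
    by blast
  \<comment> \<open>Everything except the forced zeros. From h a \<noteq> 0 it follows that neither
    \<open>Etilde N\<close> nor a coset factor outside \<open>J\<close> vanishes at a.\<close>
  define h where "h = (\<lambda>\<tau>. Etilde N \<tau> * ((\<Prod>k\<in>{..<N} - J. Etilde_coset N k \<tau>) * (\<Prod>k\<in>J. H k \<tau>)))"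
  have h: "h holomorphic_on UHP" unfolding h_def
    by (intro holomorphic_on_mult holomorphic_on_prod Etilde_holomorphic Etilde_coset_holomorphic N0 H)
  have fac: "Etilde_norm N \<tau> = (\<tau> - a) ^ (e * card J) * h \<tau>" if \<tau>: "Im \<tau> > 0" for \<tau>
  proof -
    have "(\<Prod>k<N. Etilde_coset N k \<tau>) = (\<Prod>k\<in>{..<N} - J. Etilde_coset N k \<tau>) * (\<Prod>k\<in>J. Etilde_coset N k \<tau>)"
      by (rule prod.subset_diff[OF J(1)]) simp
    also have "(\<Prod>k\<in>J. Etilde_coset N k \<tau>) = (\<Prod>k\<in>J. (\<tau> - a) ^ e * H k \<tau>)"
      by (intro prod.cong refl G \<tau>)
    also have "\<dots> = (\<tau> - a) ^ (e * card J) * (\<Prod>k\<in>J. H k \<tau>)" by (simp add: prod.distrib power_mult)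
    finally show ?thesis by (simp add: Etilde_norm_def h_def)
  qed
  have m: "e * card J > 0" using J finJ by (simp add: card_gt_0_iff)
  have inv: "Etilde_norm N (- 1 / \<tau>) = \<tau> ^ (w * (e * card J)) * Etilde_norm N \<tau>" if "Im \<tau> > 0" for \<tau>
    unfolding J(4) by (rule Etilde_norm_minus_inverse[OF N0 that \<sigma>])
  have main: "Etilde_norm N \<tau> = E \<tau> ^ (e * card J)" if "Im \<tau> > 17 / 20" for \<tau>
    by (rule eq_power(1)[OF m Etilde_norm_periodic[OF N0] inv Etilde_norm_tendsto_1[OF N] fac h]) (use that in simp_all)
  have h0: "h a \<noteq> 0"
    by (rule eq_power(2)[OF m Etilde_norm_periodic[OF N0] inv Etilde_norm_tendsto_1[OF N] fac h]) simp_all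
  have zero_a: "\<tau> = a" if \<tau>: "\<tau> \<in> F_Gamma" and P: "Etilde_norm N \<tau> = 0" for \<tau>
  proof -
    have "E \<tau> = 0" using main[OF F_Gamma_Im[OF \<tau>]] P by simp
    then obtain n :: int where n: "\<tau> = a + of_int n" using zero_iff[OF F_Gamma_Im[OF \<tau>]] by auto
    \<comment> \<open>The strip is half-open of width 1, so it contains no second translate of
      a.\<close>
    have "\<bar>of_int n\<bar> < (1 :: real)" using \<tau> a by (auto simp: F_Gamma_def n abs_less_iff)
    hence "n = 0" by linarith
    thus ?thesis by (simp add: n)
  qed
  have f0: "Etilde N \<tau> \<noteq> 0" if \<tau>: "\<tau> \<in> F_Gamma" for \<tau>
  proof
    assume "Etilde N \<tau> = 0"
    moreover from this have "\<tau> = a" by (intro zero_a[OF \<tau>]) (simp add: Etilde_norm_def)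
    ultimately show False using h0 by (simp add: h_def)
  qed
  have g0: "Etilde_coset N k \<tau> = 0 \<longleftrightarrow> \<tau> = a \<and> k \<in> J" if \<tau>: "\<tau> \<in> F_Gamma" and k: "k < N" for \<tau> k
  proof
    assume 0: "Etilde_coset N k \<tau> = 0"
    hence ta: "\<tau> = a" using k by (intro zero_a[OF \<tau>]) (auto simp: Etilde_norm_def)
    moreover have "k \<in> J"
    proof (rule ccontr)
      assume "k \<notin> J"
      hence "(\<Prod>k\<in>{..<N} - J. Etilde_coset N k a) = 0" using 0 ta k by (intro prod_zero) auto
      thus False using h0 by (simp add: h_def)
    qed
    ultimately show "\<tau> = a \<and> k \<in> J" ..
  next
    assume "\<tau> = a \<and> k \<in> J"
    thus "Etilde_coset N k \<tau> = 0" using G[of k a] Im_zero J(3) by simp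
  qed
  have ST: "Etilde N (ST k \<tau>) = 0 \<longleftrightarrow> \<tau> = a \<and> k \<in> J" if \<tau>: "\<tau> \<in> F_Gamma" and k: "k < N" for \<tau> k
  proof -
    have "Im (\<tau> + of_nat k) > 0" using F_Gamma_Im[OF \<tau>] by simp
    moreover from this have "\<tau> + of_nat k \<noteq> 0" by (metis less_irrefl zero_complex.sel(2))
    ultimately have "Etilde N (ST k \<tau>) = 0 \<longleftrightarrow> Etilde_coset N k \<tau> = 0"
      using N0 unfolding ST_def by (subst Etilde_minus_inverse) (auto simp: Etilde_coset_def)
    thus ?thesis using g0[OF \<tau> k] by simp
  qed
  show ?thesis
  proof (intro equalityI subsetI)
    fix z assume "z \<in> {\<tau> \<in> F_level N. Etilde N \<tau> = 0}"
    thus "z \<in> (\<lambda>k. ST k a) ` J" using f0 ST by (auto simp: F_level_def)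
  next
    fix z assume "z \<in> (\<lambda>k. ST k a) ` J"
    then obtain k where k: "k \<in> J" "z = ST k a" by auto
    hence "k < N" using J(1) by auto
    moreover from this have "z \<in> F_level N" using a k by (auto simp: F_level_def)
    ultimately show "z \<in> {\<tau> \<in> F_level N. Etilde N \<tau> = 0}" using ST[OF a, of k] k by simp
  qed
qed

end

section \<open>Zeros forced at elliptic points\<close>

lemma holomorphic_factor_simple:
  assumes g: "g holomorphic_on UHP" "g a = 0"
  shows "\<exists>h. h holomorphic_on UHP \<and> (\<forall>\<tau>. g \<tau> = (\<tau> - a) * h \<tau>) \<and> h a = deriv g a"
  using pole_lemma_open[OF g(1) open_UHP, of a] g(2)
  by (intro exI[of _ "\<lambda>z. if z = a then deriv g a else (g z - g a) / (z - a)"]) auto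

lemma holomorphic_factor_double:
  assumes g: "g holomorphic_on UHP" "g a = 0" "deriv g a = 0"
  shows "\<exists>h. h holomorphic_on UHP \<and> (\<forall>\<tau>. g \<tau> = (\<tau> - a) ^ 2 * h \<tau>)"
proof -
  obtain h1 where h1: "h1 holomorphic_on UHP" "\<And>\<tau>. g \<tau> = (\<tau> - a) * h1 \<tau>" "h1 a = 0"
    using holomorphic_factor_simple[OF g(1,2)] g(3) by auto
  obtain h2 where "h2 holomorphic_on UHP" "\<And>\<tau>. h1 \<tau> = (\<tau> - a) * h2 \<tau>"
    using holomorphic_factor_simple[OF h1(1,3)] by auto
  thus ?thesis using h1(2) by (auto simp: power2_eq_square)
qed

text \<open>For k^2 = -1 mod N the inversion maps the factor to itself, and at its fixed point i the
  multiplier is i^2 = -1.\<close>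

lemma Etilde_coset_i:
  assumes N: "N > 0" and k: "N dvd k * k + 1"
  shows "\<exists>h. h holomorphic_on UHP \<and> (\<forall>\<tau>. Im \<tau> > 0 \<longrightarrow> Etilde_coset N k \<tau> = (\<tau> - \<i>) ^ 1 * h \<tau>)"
proof -
  have "Etilde_coset N k \<i> = 0" using Etilde_coset_minus_inverse[OF N _ k, of \<i>] by simp
  from holomorphic_factor_simple[OF Etilde_coset_holomorphic[OF N] this] show ?thesis by auto
qed

text \<open>The factor satisfies X(-1/\<tau> - 1) = \<tau>^2 X(\<tau>), and rho is a fixed point.
  The value gets the multiplier rho^2 \<noteq> 1. Differentiating then gives X'(rho) = rho^4 X'(rho)
  with rho^4 = rho \<noteq> 1, hence a double zero.\<close>

lemma Etilde_coset_rho: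
  assumes N: "N > 0" and k: "N dvd k * Suc k + 1"
  shows "\<exists>h. h holomorphic_on UHP \<and> (\<forall>\<tau>. Im \<tau> > 0 \<longrightarrow> Etilde_coset N (Suc k) \<tau> = (\<tau> - rho) ^ 2 * h \<tau>)"
proof -
  define X where "X = Etilde_coset N (Suc k)"
  have Ir: "Im rho > 0" using Im_rho by simp
  have r0: "rho \<noteq> 0" using Ir by auto
  have r3: "rho ^ 4 = rho" using rho_poly by algebra
  have X: "X holomorphic_on UHP" unfolding X_def by (rule Etilde_coset_holomorphic[OF N])
  have tr: "X (- 1 / \<tau> - 1) = \<tau> ^ 2 * X \<tau>" if "Im \<tau> > 0" for \<tau>
    using Etilde_coset_minus_inverse[OF N that k] Etilde_coset_shift[of N k "- 1 / \<tau> - 1"] by (simp add: X_def)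
  have fix_rho: "- 1 / rho - 1 = rho" unfolding minus_inverse_rho by simp
  have "X rho = rho ^ 2 * X rho" using tr[OF Ir] by (simp only: fix_rho)
  moreover have "rho ^ 2 \<noteq> 1"
  proof
    assume "rho ^ 2 = 1"
    hence "rho = 1" using r3 by algebra
    thus False using rho_neq_1 by simp
  qed
  ultimately have X0: "X rho = 0" by simp
  have dX: "(X has_field_derivative deriv X rho) (at rho)"
    using holomorphic_derivI[OF X open_UHP] Ir by simp
  have inner: "((\<lambda>\<tau>. - 1 / \<tau> - 1) has_field_derivative 1 / rho ^ 2) (at rho)"
    using r0 by (auto intro!: derivative_eq_intros simp: power2_eq_square)
  have "((\<lambda>\<tau>. X (- 1 / \<tau> - 1)) has_field_derivative deriv X rho * (1 / rho ^ 2)) (at rho)"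
    by (rule DERIV_chain2[OF _ inner]) (simp only: fix_rho dX)
  moreover have "((\<lambda>\<tau>. \<tau> ^ 2 * X \<tau>) has_field_derivative 2 * rho * X rho + rho ^ 2 * deriv X rho) (at rho)"
    using dX by (auto intro!: derivative_eq_intros)
  hence "((\<lambda>\<tau>. X (- 1 / \<tau> - 1)) has_field_derivative 2 * rho * X rho + rho ^ 2 * deriv X rho) (at rho)"
    by (rule has_field_derivative_transform_within_open[OF _ open_UHP]) (use Ir tr in auto)
  ultimately have "deriv X rho * (1 / rho ^ 2) = 2 * rho * X rho + rho ^ 2 * deriv X rho"
    by (rule DERIV_unique)
  hence "deriv X rho = rho ^ 4 * deriv X rho"
    using r0 by (simp add: X0 field_simps)
  hence "(1 - rho) * deriv X rho = 0" unfolding r3 by (simp add: algebra_simps)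
  hence "deriv X rho = 0" using rho_neq_1 by simp
  from holomorphic_factor_double[OF X X0 this] show ?thesis unfolding X_def by auto
qed

lemma bij_betw_involution:
  assumes "\<And>x. x \<in> A \<Longrightarrow> f x \<in> A" "\<And>x. x \<in> A \<Longrightarrow> f (f x) = x"
  shows "bij_betw f A A"
  by (rule bij_betw_byWitness[where f' = f]) (use assms in auto)

lemma i_in_F_Gamma: "\<i> \<in> F_Gamma"
  by (simp add: F_Gamma_def)

lemma rho_in_F_Gamma: "rho \<in> F_Gamma"
  by (simp add: F_Gamma_def rho_eq power_divide)

theorem theorem1:
  shows "{\<tau> \<in> F_level 2. Etilde 2 \<tau> = 0} = {- 1 / (\<i> + 1)} \<and>
    {\<tau> \<in> F_level 3. Etilde 3 \<tau> = 0} = {- 1 / (rho + 2)} \<and>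
    {\<tau> \<in> F_level 5. Etilde 5 \<tau> = 0} = {- 1 / (\<i> + 2), - 1 / (\<i> + 3)} \<and>
    {\<tau> \<in> F_level 7. Etilde 7 \<tau> = 0} = {- 1 / (rho + 3), - 1 / (rho + 5)}"
proof (intro conjI)
  \<comment> \<open>Modulo 2 the only unit is 1, and 1*1 + 1 = 2.\<close>
  have "{\<tau> \<in> F_level 2. Etilde 2 \<tau> = 0} = (\<lambda>k. ST k \<i>) ` {1}"
  proof (rule E6.Etilde_zeros_level[where e = 1 and \<sigma> = "\<lambda>k. k"])
    show "\<exists>h. h holomorphic_on UHP \<and> (\<forall>\<tau>. Im \<tau> > 0 \<longrightarrow> Etilde_coset 2 k \<tau> = (\<tau> - \<i>) ^ 1 * h \<tau>)"
      if "k \<in> {1}" for k using that by (intro Etilde_coset_i) auto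
  qed (auto simp: i_in_F_Gamma intro!: bij_betw_involution)
  thus "{\<tau> \<in> F_level 2. Etilde 2 \<tau> = 0} = {- 1 / (\<i> + 1)}" by (simp add: ST_def)
next
  have S: "{1..<3} = {1, 2 :: nat}" by auto
  \<comment> \<open>The pair of consecutive indices is 1, 2, since 1*2 + 1 = 3; its upper member is
    the elliptic index.\<close>
  have "{\<tau> \<in> F_level 3. Etilde 3 \<tau> = 0} = (\<lambda>k. ST k rho) ` {2}"
  proof (rule E4.Etilde_zeros_level[where e = 2 and \<sigma> = "\<lambda>k. 3 - k"])
    show "\<exists>h. h holomorphic_on UHP \<and> (\<forall>\<tau>. Im \<tau> > 0 \<longrightarrow> Etilde_coset 3 k \<tau> = (\<tau> - rho) ^ 2 * h \<tau>)"
      if "k \<in> {2}" for k using that Etilde_coset_rho[of 3 1] by (simp add: Suc_1 del: One_nat_def)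
    show "bij_betw (\<lambda>k. 3 - k) {1..<3} {1..<3 :: nat}" by (rule bij_betw_involution) auto
    show "3 dvd k * (3 - k) + 1" if "k \<in> {1..<3}" for k :: nat using that unfolding S by auto
  qed (auto simp: rho_in_F_Gamma)
  thus "{\<tau> \<in> F_level 3. Etilde 3 \<tau> = 0} = {- 1 / (rho + 2)}" by (simp add: ST_def)
next
  have S: "{1..<5} = {1, 2, 3, 4 :: nat}" by auto
  \<comment> \<open>Negative inverses modulo 5: 1 and 4 are exchanged, while 2 and 3, the square
    roots of -1, are fixed.\<close>
  define \<sigma> :: "nat \<Rightarrow> nat" where "\<sigma> = (\<lambda>k. if k \<in> {1, 4} then 5 - k else k)"
  have "{\<tau> \<in> F_level 5. Etilde 5 \<tau> = 0} = (\<lambda>k. ST k \<i>) ` {2, 3}"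
  proof (rule E6.Etilde_zeros_level[where e = 1 and \<sigma> = \<sigma>])
    show "\<exists>h. h holomorphic_on UHP \<and> (\<forall>\<tau>. Im \<tau> > 0 \<longrightarrow> Etilde_coset 5 k \<tau> = (\<tau> - \<i>) ^ 1 * h \<tau>)"
      if "k \<in> {2, 3}" for k using that by (intro Etilde_coset_i) auto
    show "bij_betw \<sigma> {1..<5} {1..<5}" unfolding S by (rule bij_betw_involution) (auto simp: \<sigma>_def)
    show "5 dvd k * \<sigma> k + 1" if "k \<in> {1..<5}" for k using that unfolding S by (auto simp: \<sigma>_def)
  qed (auto simp: i_in_F_Gamma)
  thus "{\<tau> \<in> F_level 5. Etilde 5 \<tau> = 0} = {- 1 / (\<i> + 2), - 1 / (\<i> + 3)}" by (simp add: ST_def)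
next
  have S: "{1..<7} = {1, 2, 3, 4, 5, 6 :: nat}" by auto
  \<comment> \<open>Negative inverses modulo 7 pair 1 with 6, 2 with 3 and 4 with 5. The upper
    members of the pairs (2, 3) and (4, 5) are the elliptic indices.\<close>
  define \<sigma> :: "nat \<Rightarrow> nat" where
    "\<sigma> = (\<lambda>k. if k \<in> {1, 6} then 7 - k else if k \<in> {2, 3} then 5 - k else 9 - k)"
  have "{\<tau> \<in> F_level 7. Etilde 7 \<tau> = 0} = (\<lambda>k. ST k rho) ` {3, 5}"
  proof (rule E4.Etilde_zeros_level[where e = 2 and \<sigma> = \<sigma>])
    show "\<exists>h. h holomorphic_on UHP \<and> (\<forall>\<tau>. Im \<tau> > 0 \<longrightarrow> Etilde_coset 7 k \<tau> = (\<tau> - rho) ^ 2 * h \<tau>)"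
      if "k \<in> {3, 5}" for k using that Etilde_coset_rho[of 7 2] Etilde_coset_rho[of 7 4] by auto
    show "bij_betw \<sigma> {1..<7} {1..<7}" unfolding S by (rule bij_betw_involution) (auto simp: \<sigma>_def)
    show "7 dvd k * \<sigma> k + 1" if "k \<in> {1..<7}" for k using that unfolding S by (auto simp: \<sigma>_def)
  qed (auto simp: rho_in_F_Gamma)
  thus "{\<tau> \<in> F_level 7. Etilde 7 \<tau> = 0} = {- 1 / (rho + 3), - 1 / (rho + 5)}" by (simp add: ST_def)
qed

end
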